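(* Let $\mathcal B$ be a Besov body with $\gamma>1/2$ and radius $c>0$, and let $1/\sqrt2<\varrho<1$. Then there is a mean zero Gaussian process $W$ on $[\varrho,1]$ such that the pivot process $B_n=\{B_n(u):u\in[\varrho,1]\}$ converges weakly to $W$ uniformly over $\mu\in\mathcal B$, in the sense that $$\sup_{\mu\in\mathcal B}m(\mathcal L(B_n),\mathcal L(W))\to0\quad(n\to\infty),$$ where $m$ is any metric that metrizes weak convergence on $\ell^\infty[\varrho,1]$ and $\mathcal L(\cdot)$ denotes the law.
   Context: Indexing. $J_0$ is a fixed integer and $n=2^{J_1+1}$ (limits are along such $n$). A sequence $\mu=(\mu_1,\mu_2,\dots)$ collects wavelet coefficients: $\mu_{k+1}=\alpha_k$ for $0\le k<2^{J_0}$ and $\mu_{2^j+k+1}=\beta_{j,k}$ for $j\ge J_0$, $0\le k<2^j$. Besov body. For real $p,q\ge1$ and $\varsigma$, $\|\mu\|_{p,q}^\varsigma=\big(\sum_{j\ge J_0}(2^{j(\varsigma+1/2-1/p)}(\sum_k|\beta_{j,k}|^p)^{1/p})^q\big)^{1/q}$; $\gamma=\varsigma$ if $p\ge2$ and $\gamma=\varsigma+\frac12-\frac1p$ if $1\le p<2$. A Besov body with $\gamma>1/2$ and radius $c$ is $\{\mu:\|\mu\|_{p,q}^\varsigma\le c\}$ for some $p,q,\varsigma$ with $\gamma>1/2$. Pivot process. $\sigma>0$ is fixed and known; given $\mu$, $X_1,\dots,X_n$ are independent with $X_i\sim N(\mu_i,\sigma^2/n)$. Let $\sigma_n^2=\sigma^2/n$,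 $\rho_n=\sqrt{2\log n}$, $r_n=\rho_n\sigma/\sqrt n$. For $t\ge0$ let $$\hat\mu_i(t)=(X_i-t)\mathbf 1\{X_i>t\}+(X_i+t)\mathbf 1\{X_i<-t\},$$ $$L_n(t)=\sum_{i=1}^n(\hat\mu_i(t)-\mu_i)^2,\qquad S_n(t)=\sum_{i=1}^n\big(\sigma_n^2-2\sigma_n^2\mathbf 1\{X_i^2\le t^2\}+\min(X_i^2,t^2)\big),$$ and $B_n(u)=\sqrt n\,(L_n(ur_n)-S_n(ur_n))$. *)

theory Defs
  imports "HOL-Probability.Probability"
begin

section \<open>Besov bodies of wavelet coefficients\<close>

text \<open>
  A coefficient sequence is a function on \<open>nat\<close> of which only the entries with index \<open>\<ge> 1\<close> are
  meaningful: \<open>\<alpha>\<^sub>k = \<mu> (k + 1)\<close> for \<open>k < 2 ^ J0\<close>, and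
  \<open>\<beta>\<^sub>j\<^sub>k = \<mu> (2 ^ j + k + 1)\<close> for \<open>j \<ge> J0\<close>, \<open>k < 2 ^ j\<close>.
  The smoothness index is called \<open>s\<close>; the Besov norm does not involve the \<open>\<alpha>\<^sub>k\<close>.
\<close>

definition beta_coeff :: "(nat \<Rightarrow> real) \<Rightarrow> nat \<Rightarrow> nat \<Rightarrow> real" where
  "beta_coeff \<mu> j k = \<mu> (2 ^ j + k + 1)"

definition besov_level :: "real \<Rightarrow> real \<Rightarrow> real \<Rightarrow> (nat \<Rightarrow> real) \<Rightarrow> nat \<Rightarrow> real" where
  "besov_level p q s \<mu> j =
     (2 powr (real j * (s + 1/2 - 1/p)) *
        (\<Sum>k<2 ^ j. \<bar>beta_coeff \<mu> j k\<bar> powr p) powr (1/p)) powr q"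

definition besov_norm :: "nat \<Rightarrow> real \<Rightarrow> real \<Rightarrow> real \<Rightarrow> (nat \<Rightarrow> real) \<Rightarrow> ereal" where
  "besov_norm J0 p q s \<mu> =
     (if besov_level p q s \<mu> summable_on {J0..}
      then ereal ((\<Sum>\<^sub>\<infinity>j\<in>{J0..}. besov_level p q s \<mu> j) powr (1/q))
      else \<infinity>)"

definition besov_gamma :: "real \<Rightarrow> real \<Rightarrow> real" where
  "besov_gamma p s = (if p \<ge> 2 then s else s + 1/2 - 1/p)"

definition besov_body :: "nat \<Rightarrow> real \<Rightarrow> real \<Rightarrow> real \<Rightarrow> real \<Rightarrow> (nat \<Rightarrow> real) set" where
  "besov_body J0 p q s c = {\<mu>. besov_norm J0 p q s \<mu> \<le> ereal c}"


section \<open>Weak convergence in the space of bounded functions\<close>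

text \<open>
  \<open>funspace\<close> consists of the bounded functions on \<open>T\<close> (extensional, i.e. \<open>undefined\<close> off \<open>T\<close>)
  with the supremum metric.
\<close>

definition linf :: "real set \<Rightarrow> (real \<Rightarrow> real) metric" where
  "linf T = funspace T euclidean_metric"

definition bounded_continuous_functionals :: "real set \<Rightarrow> ((real \<Rightarrow> real) \<Rightarrow> real) set" where
  "bounded_continuous_functionals T =
     {f. continuous_map (mtopology_of (linf T)) euclideanreal f \<and> bounded (f ` mspace (linf T))}"

text \<open>
  The space is not separable, and the pivot process (whose paths have jumps) is in general not Borel
  measurable as a map into it.  Weak convergence is therefore understood in the sense of
  Hoffmann-Jorgensen: the maps are arbitrary, expectations are outer expectations, and limits are
  Borel measurable with separable range up to a null set.
\<close>

definition outer_expectation :: "'w measure \<Rightarrow> ('w \<Rightarrow> real) \<Rightarrow> real" where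
  "outer_expectation M g =
     Inf {(\<integral>\<omega>. U \<omega> \<partial>M) | U. integrable M U \<and> (\<forall>\<omega>\<in>space M. g \<omega> \<le> U \<omega>)}"

definition random_map :: "real set \<Rightarrow> 'w measure \<Rightarrow> ('w \<Rightarrow> real \<Rightarrow> real) \<Rightarrow> bool" where
  "random_map T M Y \<longleftrightarrow> prob_space M \<and> Y \<in> space M \<rightarrow> mspace (linf T)"

definition separable_borel_map :: "real set \<Rightarrow> 'w measure \<Rightarrow> ('w \<Rightarrow> real \<Rightarrow> real) \<Rightarrow> bool" where
  "separable_borel_map T M Y \<longleftrightarrow>
     random_map T M Y \<and>
     (\<forall>G. openin (mtopology_of (linf T)) G \<longrightarrow> Y -` G \<inter> space M \<in> sets M) \<and>
     (\<exists>D. countable D \<and> D \<subseteq> mspace (linf T) \<and>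
        (AE \<omega> in M. Y \<omega> \<in> mtopology_of (linf T) closure_of D))"

text \<open>
  A map that is not Borel measurable does not induce a Borel measure; its law is the functional
  \<open>f \<mapsto> E* f(Y)\<close> on bounded continuous \<open>f\<close>.  For a Borel measurable map this is integration with
  respect to the image measure, and so determines that measure.
\<close>

definition law :: "real set \<Rightarrow> 'w measure \<Rightarrow> ('w \<Rightarrow> real \<Rightarrow> real) \<Rightarrow> ((real \<Rightarrow> real) \<Rightarrow> real) \<Rightarrow> real" where
  "law T M Y =
     restrict (\<lambda>f. outer_expectation M (\<lambda>\<omega>. f (Y \<omega>))) (bounded_continuous_functionals T)"

definition laws :: "'w itself \<Rightarrow> real set \<Rightarrow> (((real \<Rightarrow> real) \<Rightarrow> real) \<Rightarrow> real) set" where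
  "laws _ T = {law T M Y | (M :: 'w measure) Y. random_map T M Y}"

definition separable_laws :: "'w itself \<Rightarrow> real set \<Rightarrow> (((real \<Rightarrow> real) \<Rightarrow> real) \<Rightarrow> real) set" where
  "separable_laws _ T = {law T M Y | (M :: 'w measure) Y. separable_borel_map T M Y}"

definition weakly_converges ::
    "real set \<Rightarrow> (nat \<Rightarrow> ((real \<Rightarrow> real) \<Rightarrow> real) \<Rightarrow> real) \<Rightarrow> (((real \<Rightarrow> real) \<Rightarrow> real) \<Rightarrow> real) \<Rightarrow> bool" where
  "weakly_converges T \<Lambda>s \<Lambda> \<longleftrightarrow>
     (\<forall>f\<in>bounded_continuous_functionals T. (\<lambda>k. \<Lambda>s k f) \<longlonglongrightarrow> \<Lambda> f)"

text \<open>
  Metrization refers, as usual for this mode of convergence, to limits that are separable and Borel.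
  An example is the bounded Lipschitz metric, the supremum of
  \<open>\<bar>E* f(Y) - E* f(Z)\<bar>\<close> over all \<open>f\<close> bounded by 1 with Lipschitz constant 1.
\<close>

definition metrizes_weak_convergence ::
    "'w itself \<Rightarrow> real set \<Rightarrow>
     ((((real \<Rightarrow> real) \<Rightarrow> real) \<Rightarrow> real) \<Rightarrow> (((real \<Rightarrow> real) \<Rightarrow> real) \<Rightarrow> real) \<Rightarrow> real) \<Rightarrow> bool" where
  "metrizes_weak_convergence W T m \<longleftrightarrow>
     Metric_space (laws W T) m \<and>
     (\<forall>\<Lambda>s \<Lambda>. (\<forall>k. \<Lambda>s k \<in> laws W T) \<longrightarrow> \<Lambda> \<in> separable_laws W T \<longrightarrow>
        ((\<lambda>k. m (\<Lambda>s k) \<Lambda>) \<longlonglongrightarrow> 0 \<longleftrightarrow> weakly_converges T \<Lambda>s \<Lambda>))"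


section \<open>Gaussian processes\<close>

text \<open>Variance 0 is allowed, hence the case distinction.\<close>

definition normal_rv :: "'w measure \<Rightarrow> ('w \<Rightarrow> real) \<Rightarrow> real \<Rightarrow> real \<Rightarrow> bool" where
  "normal_rv M Y a s \<longleftrightarrow>
     Y \<in> borel_measurable M \<and> s \<ge> 0 \<and>
     (if s = 0 then AE \<omega> in M. Y \<omega> = a else distributed M lborel Y (normal_density a s))"

definition gaussian_process :: "real set \<Rightarrow> 'w measure \<Rightarrow> ('w \<Rightarrow> real \<Rightarrow> real) \<Rightarrow> bool" where
  "gaussian_process T M Y \<longleftrightarrow>
     prob_space M \<and>
     (\<forall>F b. finite F \<and> F \<subseteq> T \<longrightarrow> (\<exists>a s. normal_rv M (\<lambda>\<omega>. \<Sum>u\<in>F. b u * Y \<omega> u) a s))"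

definition mean_zero_gaussian_process :: "real set \<Rightarrow> 'w measure \<Rightarrow> ('w \<Rightarrow> real \<Rightarrow> real) \<Rightarrow> bool" where
  "mean_zero_gaussian_process T M Y \<longleftrightarrow>
     gaussian_process T M Y \<and> (\<forall>u\<in>T. (\<integral>\<omega>. Y \<omega> u \<partial>M) = 0)"


section \<open>The pivot process\<close>

definition sequence_model ::
    "real \<Rightarrow> nat \<Rightarrow> (nat \<Rightarrow> real) \<Rightarrow> 'w measure \<Rightarrow> (nat \<Rightarrow> 'w \<Rightarrow> real) \<Rightarrow> bool" where
  "sequence_model \<sigma> n \<mu> M X \<longleftrightarrow>
     prob_space M \<and>
     prob_space.indep_vars M (\<lambda>_. borel) X {1..n} \<and>
     (\<forall>i\<in>{1..n}. distributed M lborel (X i) (normal_density (\<mu> i) (\<sigma> / sqrt (real n))))"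

definition soft_threshold :: "real \<Rightarrow> real \<Rightarrow> real" where
  "soft_threshold t x = (x - t) * of_bool (x > t) + (x + t) * of_bool (x < - t)"

text \<open>In the following, \<open>x\<close> is a realization of \<open>(X\<^sub>1, \<dots>, X\<^sub>n)\<close>.\<close>

definition loss :: "nat \<Rightarrow> (nat \<Rightarrow> real) \<Rightarrow> (nat \<Rightarrow> real) \<Rightarrow> real \<Rightarrow> real" where
  "loss n \<mu> x t = (\<Sum>i=1..n. (soft_threshold t (x i) - \<mu> i)\<^sup>2)"

definition sure_risk :: "real \<Rightarrow> nat \<Rightarrow> (nat \<Rightarrow> real) \<Rightarrow> real \<Rightarrow> real" where
  "sure_risk \<sigma> n x t =
     (\<Sum>i=1..n. \<sigma>\<^sup>2 / real n - 2 * (\<sigma>\<^sup>2 / real n) * of_bool ((x i)\<^sup>2 \<le> t\<^sup>2) + min ((x i)\<^sup>2) (t\<^sup>2))"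

definition threshold_scale :: "real \<Rightarrow> nat \<Rightarrow> real" where
  "threshold_scale \<sigma> n = sqrt (2 * ln (real n)) * \<sigma> / sqrt (real n)"

definition pivot_process ::
    "real set \<Rightarrow> real \<Rightarrow> nat \<Rightarrow> (nat \<Rightarrow> real) \<Rightarrow> (nat \<Rightarrow> real) \<Rightarrow> real \<Rightarrow> real" where
  "pivot_process T \<sigma> n \<mu> x =
     (\<lambda>u\<in>T. sqrt (real n) *
        (loss n \<mu> x (u * threshold_scale \<sigma> n) - sure_risk \<sigma> n x (u * threshold_scale \<sigma> n)))"

end

theory Submission
  imports Defs "HOL-Real_Asymp.Real_Asymp"
begin

text \<open>
  Write \<open>X\<^sub>i = \<mu>\<^sub>i + v e\<^sub>i\<close> with \<open>v = \<sigma> / sqrt n\<close>. If every coordinate were thresholded to 0 and had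
  negligible mean, the pivot process would be the constant function with value
  \<open>Z\<^sub>n = (\<sigma>\<^sup>2 / sqrt n) \<Sum>\<^sub>i (1 - e\<^sub>i\<^sup>2)\<close>, which by the central limit theorem tends to \<open>N(0, 2\<sigma>\<^sup>4)\<close>;
  so the limit process is constant in \<open>u\<close>. The error is bounded uniformly in \<open>u\<close> and small in mean:
  choose \<open>2\<^sup>j \<approx> n\<^sup>a\<close> with \<open>1/(4\<gamma>) < a < 1/2\<close>. The coordinates of levels below \<open>j\<close>, and the higher ones
  with \<open>\<bar>\<mu>\<^sub>i\<bar> > \<delta> r\<^sub>n\<close>, number \<open>o(sqrt n / sqrt (log n))\<close> by the Besov bound \<open>\<Sum>\<^sub>k \<beta>\<^sub>j\<^sub>k\<^sup>2 \<le> c\<^sup>2 2\<^sup>-\<^sup>2\<^sup>\<gamma>\<^sup>j\<close> and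
  contribute \<open>O(sqrt (log n) / sqrt n)\<close> each. The remaining ones contribute the linear term
  \<open>- 2\<sigma> \<Sum> \<mu>\<^sub>i e\<^sub>i\<close>, of vanishing variance, and an error only if \<open>\<bar>e\<^sub>i\<bar> > (\<rho> - \<delta>) sqrt (2 log n)\<close>;
  the latter is negligible in total because \<open>(\<rho> - \<delta>)\<^sup>2 > 1/2\<close>.
\<close>

section \<open>Energy of the tail coefficients in a Besov body\<close>

text \<open>Each summand is at most the total \<open>S\<close>, so \<open>f x powr r\<close> is at
  most \<open>f x * S powr (r - 1)\<close>. This yields the embedding of l^p into l^2 for
  \<open>p < 2\<close>.\<close>

lemma sum_le_powr_sum:
  fixes f :: "'a \<Rightarrow> real"
  assumes "finite A" "r \<ge> 1" "\<And>x. x \<in> A \<Longrightarrow> f x \<ge> 0"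
  shows "(\<Sum>x\<in>A. f x powr r) \<le> (\<Sum>x\<in>A. f x) powr r"
proof (cases "(\<Sum>x\<in>A. f x) = 0")
  case True
  then have "\<And>x. x \<in> A \<Longrightarrow> f x = 0"
    using assms sum_nonneg_eq_0_iff by metis
  then show ?thesis by simp
next
  case False
  define S where "S = (\<Sum>x\<in>A. f x)"
  have S: "S > 0"
    using False sum_nonneg[of A f] assms unfolding S_def by fastforce
  have "(\<Sum>x\<in>A. f x powr r) \<le> (\<Sum>x\<in>A. f x * S powr (r - 1))"
  proof (rule sum_mono)
    fix x assume x: "x \<in> A"
    have le: "f x \<le> S" unfolding S_def
      using assms x by (intro member_le_sum) auto
    show "f x powr r \<le> f x * S powr (r - 1)"
    proof (cases "f x = 0")
      case False
      then have "f x > 0" using assms x by fastforce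
      then have "f x powr r = f x * f x powr (r - 1)"
        by (simp add: powr_mult_base)
      also have "\<dots> \<le> f x * S powr (r - 1)"
        using le \<open>f x > 0\<close> assms by (intro mult_left_mono powr_mono2) auto
      finally show ?thesis .
    qed simp
  qed
  also have "\<dots> = S * S powr (r - 1)"
    by (simp add: S_def sum_distrib_right)
  also have "\<dots> = S powr r"
    using S by (simp add: powr_mult_base)
  finally show ?thesis by (simp add: S_def)
qed

text \<open>The endpoint 0 has to be included because coefficients may vanish. There the inequality
  reduces to t^r \<le> t for t in (0,1).\<close>

lemma convex_on_powr:
  assumes "r \<ge> 1"
  shows "convex_on {0..} (\<lambda>x::real. x powr r)"
proof (rule convex_onI)
  have scale: "(t * z) powr r \<le> t * z powr r" if "0 < t" "t < 1" "z \<ge> 0" for t z :: real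
  proof -
    have "(t * z) powr r = t powr r * z powr r"
      using that by (simp add: powr_mult)
    also have "\<dots> \<le> t powr 1 * z powr r"
      using that assms by (intro mult_right_mono powr_mono') auto
    finally show ?thesis using that by simp
  qed
  fix t x y :: real
  assume t: "0 < t" "t < 1" and xy: "x \<in> {0..}" "y \<in> {0..}"
  show "((1 - t) *\<^sub>R x + t *\<^sub>R y) powr r \<le> (1 - t) * x powr r + t * y powr r"
  proof (cases "x = 0 \<or> y = 0")
    case True
    then show ?thesis using scale[of t y] scale[of "1 - t" x] t xy by auto
  next
    case False
    then show ?thesis
      using convex_onD[OF powr_convex[OF assms], of t x y] t xy by auto
  qed
qed auto

text \<open>Jensen's inequality with uniform weights. For \<open>p \<ge> 2\<close> it compares l^2
  with l^p on a level, at the cost of a power of the level size.\<close>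

lemma powr_mean_le_mean_powr:
  fixes f :: "'a \<Rightarrow> real"
  assumes "finite A" "A \<noteq> {}" "r \<ge> 1" "\<And>x. x \<in> A \<Longrightarrow> f x \<ge> 0"
  shows "((\<Sum>x\<in>A. f x) / card A) powr r \<le> (\<Sum>x\<in>A. f x powr r) / card A"
proof -
  have "(\<Sum>x\<in>A. (1 / card A) *\<^sub>R f x) powr r \<le> (\<Sum>x\<in>A. (1 / card A) * f x powr r)"
    using assms
    by (intro convex_on_sum[where C = "{0..}" and f = "\<lambda>x. x powr r"] convex_on_powr) auto
  then show ?thesis
    by (simp add: sum_divide_distrib)
qed

text \<open>A finite norm forces summability of the levels, and one term of a nonnegative series is
  at most its sum.\<close>

lemma besov_body_level_le:
  assumes "\<mu> \<in> besov_body J0 p q s c" "q \<ge> 1" "c > 0" "j \<ge> J0"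
  shows "2 powr (real j * (s + 1/2 - 1/p)) * (\<Sum>k<2 ^ j. \<bar>beta_coeff \<mu> j k\<bar> powr p) powr (1/p) \<le> c"
proof -
  define L where "L = 2 powr (real j * (s + 1/2 - 1/p)) *
    (\<Sum>k<2 ^ j. \<bar>beta_coeff \<mu> j k\<bar> powr p) powr (1/p)"
  have L0: "L \<ge> 0" by (simp add: L_def)
  have *: "besov_norm J0 p q s \<mu> \<le> ereal c"
    using assms by (simp add: besov_body_def)
  then have sm: "besov_level p q s \<mu> summable_on {J0..}"
    by (auto simp: besov_norm_def split: if_splits)
  have nn: "besov_level p q s \<mu> i \<ge> 0" for i by (simp add: besov_level_def)
  have "besov_level p q s \<mu> j \<le> (\<Sum>\<^sub>\<infinity>j\<in>{J0..}. besov_level p q s \<mu> j)"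
    using finite_sum_le_infsum[OF sm, of "{j}"] nn assms by auto
  then have "L powr q \<le> (\<Sum>\<^sub>\<infinity>j\<in>{J0..}. besov_level p q s \<mu> j)"
    by (simp add: besov_level_def L_def)
  then have "(L powr q) powr (1/q) \<le> (\<Sum>\<^sub>\<infinity>j\<in>{J0..}. besov_level p q s \<mu> j) powr (1/q)"
    using assms by (intro powr_mono2) auto
  also have "\<dots> \<le> c" using * sm by (simp add: besov_norm_def)
  finally show ?thesis
    using assms L0 by (simp add: powr_powr flip: L_def)
qed

text \<open>The two cases in the definition of \<gamma> arise here. For \<open>p < 2\<close> the
  embedding of l^p into l^2 loses nothing and keeps the exponent \<open>s + 1/2 - 1/p\<close>; for
  \<open>p \<ge> 2\<close> Jensen over \<open>2 ^ j\<close> coordinates costs the factor 2^(j(1 -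
  2/p)), which turns that exponent into \<open>s\<close>.\<close>

lemma besov_body_level_square_sum_le:
  assumes \<mu>: "\<mu> \<in> besov_body J0 p q s c" and "p \<ge> 1" "q \<ge> 1" "c > 0" "j \<ge> J0"
  shows "(\<Sum>k<2 ^ j. (beta_coeff \<mu> j k)\<^sup>2) \<le> c\<^sup>2 * 2 powr (- (2 * besov_gamma p s * real j))"
proof -
  define N where "N = (\<Sum>k<2 ^ j. \<bar>beta_coeff \<mu> j k\<bar> powr p)"
  define w where "w = s + 1/2 - 1/p"
  have N0: "N \<ge> 0" by (simp add: N_def sum_nonneg)
  have "2 powr (real j * w) * N powr (1/p) \<le> c"
    using besov_body_level_le[OF \<mu>] assms by (simp add: N_def w_def)
  then have "N powr (1/p) \<le> c * 2 powr (- (real j * w))"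
    by (simp add: powr_minus field_simps)
  then have "(N powr (1/p)) powr 2 \<le> (c * 2 powr (- (real j * w))) powr 2"
    by (intro powr_mono2) auto
  also have "\<dots> = c\<^sup>2 * 2 powr (- (2 * w * real j))"
    using \<open>c > 0\<close> by (simp add: powr_mult powr_powr powr_numeral mult_ac)
  finally have N: "N powr (2/p) \<le> c\<^sup>2 * 2 powr (- (2 * w * real j))"
    by (simp add: powr_powr)
  show ?thesis
  proof (cases "p \<ge> 2")
    case False
    have "(\<Sum>k<2 ^ j. (beta_coeff \<mu> j k)\<^sup>2) = (\<Sum>k<2 ^ j. (\<bar>beta_coeff \<mu> j k\<bar> powr p) powr (2/p))"
      using \<open>p \<ge> 1\<close> by (simp add: powr_powr powr_numeral)
    also have "\<dots> \<le> N powr (2/p)"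
      unfolding N_def using False \<open>p \<ge> 1\<close> by (intro sum_le_powr_sum) auto
    finally show ?thesis
      using N False by (simp add: besov_gamma_def w_def)
  next
    case True
    define Q where "Q = (\<Sum>k<2 ^ j. (beta_coeff \<mu> j k)\<^sup>2)"
    have Q0: "Q \<ge> 0" by (simp add: Q_def sum_nonneg)
    have "(Q / 2 ^ j) powr (p/2) \<le> N / 2 ^ j"
    proof -
      have "\<bar>y\<bar> powr p = (y\<^sup>2) powr (p/2)" for y :: real
      proof -
        have "(y\<^sup>2) powr (p/2) = (\<bar>y\<bar> powr 2) powr (p/2)" by (simp add: powr_numeral)
        then show ?thesis by (simp only: powr_powr) simp
      qed
      then have "N = (\<Sum>k<2 ^ j. ((beta_coeff \<mu> j k)\<^sup>2) powr (p/2))"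
        by (simp add: N_def)
      moreover have "{..<(2::nat) ^ j} \<noteq> {}" by (simp add: lessThan_empty_iff)
      ultimately show ?thesis
        using True powr_mean_le_mean_powr[of "{..<(2::nat)^j}" "p/2" "\<lambda>k. (beta_coeff \<mu> j k)\<^sup>2"]
        by (simp add: Q_def)
    qed
    then have "((Q / 2 ^ j) powr (p/2)) powr (2/p) \<le> (N / 2 ^ j) powr (2/p)"
      using True by (intro powr_mono2) auto
    then have "Q / 2 ^ j \<le> (N / 2 ^ j) powr (2/p)"
      using True Q0 by (simp add: powr_powr)
    also have "\<dots> = N powr (2/p) / 2 powr (real j * (2/p))"
      using N0 by (simp add: powr_divide powr_powr flip: powr_realpow)
    finally have "Q \<le> N powr (2/p) * (2 powr real j / 2 powr (real j * (2/p)))"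
      by (simp add: field_simps powr_realpow)
    also have "\<dots> \<le> (c\<^sup>2 * 2 powr (- (2 * w * real j))) * (2 powr real j / 2 powr (real j * (2/p)))"
      using N by (intro mult_right_mono) auto
    also have "\<dots> = c\<^sup>2 * 2 powr (- (2 * w * real j) + real j - real j * (2/p))"
      by (simp add: powr_add powr_diff powr_minus field_simps)
    also have "- (2 * w * real j) + real j - real j * (2/p) = - (2 * s * real j)"
      by (simp add: w_def algebra_simps)
    finally show ?thesis
      using True by (simp add: Q_def besov_gamma_def)
  qed
qed

text \<open>With one-based indices, level \<open>j\<close> occupies exactly this block, so an
  initial segment of length \<open>2 ^ b\<close> ends at a level boundary.\<close>

lemma sum_dyadic_block:
  "(\<Sum>i\<in>{2 ^ j + 1..2 ^ Suc j}. f i) = (\<Sum>k<2 ^ j. f (2 ^ j + k + 1 :: nat))"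
  by (rule sum.reindex_bij_witness[of _ "\<lambda>k. 2 ^ j + k + 1" "\<lambda>i. i - 2 ^ j - 1"]) auto

text \<open>The level energies decay geometrically with ratio 2^(-2\<gamma>), which is below 1/2, so
  the whole tail is at most twice its first bound.\<close>

lemma besov_body_tail_square_sum_le:
  assumes \<mu>: "\<mu> \<in> besov_body J0 p q s c" and "p \<ge> 1" "q \<ge> 1" "c > 0" "a \<ge> J0"
    and \<gamma>: "besov_gamma p s > 1/2"
  shows "(\<Sum>i\<in>{2 ^ a + 1..2 ^ b}. (\<mu> i)\<^sup>2) \<le> 2 * c\<^sup>2 * 2 powr (- (2 * besov_gamma p s * real a))"
proof -
  define \<gamma> where "\<gamma> = besov_gamma p s"
  \<comment> \<open>The subtracted term makes the induction over levels telescope.\<close>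
  have *: "(\<Sum>i\<in>{2 ^ a + 1..2 ^ b}. (\<mu> i)\<^sup>2) \<le>
      2 * c\<^sup>2 * (2 powr (- (2 * \<gamma> * real a)) - 2 powr (- (2 * \<gamma> * real b)))" if "a \<le> b" for b
    using that
  proof (induction b rule: dec_induct)
    case (step j)
    have "(2::nat) ^ a \<le> 2 ^ j" using step by (intro power_increasing) auto
    then have "{2 ^ a + 1..2 ^ Suc j} = {2 ^ a + 1..2 ^ j} \<union> {2 ^ j + 1..2 ^ Suc j :: nat}"
      by (auto; linarith)
    then have "(\<Sum>i\<in>{2 ^ a + 1..2 ^ Suc j}. (\<mu> i)\<^sup>2) =
        (\<Sum>i\<in>{2 ^ a + 1..2 ^ j}. (\<mu> i)\<^sup>2) + (\<Sum>i\<in>{2 ^ j + 1..2 ^ Suc j}. (\<mu> i)\<^sup>2)"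
      by (simp only:) (rule sum.union_disjoint; auto)
    also have "(\<Sum>i\<in>{2 ^ j + 1..2 ^ Suc j}. (\<mu> i)\<^sup>2) = (\<Sum>k<2 ^ j. (beta_coeff \<mu> j k)\<^sup>2)"
      unfolding sum_dyadic_block beta_coeff_def ..
    also have "\<dots> \<le> c\<^sup>2 * 2 powr (- (2 * \<gamma> * real j))"
      unfolding \<gamma>_def using assms step by (intro besov_body_level_square_sum_le[OF \<mu>]) auto
    \<comment> \<open>Since the ratio is at most 1/2, a geometric term is at most twice its drop to
      the next term.\<close>
    also have "\<dots> \<le> 2 * c\<^sup>2 * (2 powr (- (2 * \<gamma> * real j)) - 2 powr (- (2 * \<gamma> * real (Suc j))))"
    proof -
      have "2 powr (- (2 * \<gamma> * real (Suc j))) = 2 powr (- (2 * \<gamma> * real j)) * 2 powr (- (2 * \<gamma>))"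
        by (simp add: algebra_simps flip: powr_add)
      also have "\<dots> \<le> 2 powr (- (2 * \<gamma> * real j)) * 2 powr (- 1)"
        using \<gamma> by (intro mult_left_mono powr_mono) (auto simp: \<gamma>_def)
      finally have "2 powr (- (2 * \<gamma> * real j)) \<le>
          2 * (2 powr (- (2 * \<gamma> * real j)) - 2 powr (- (2 * \<gamma> * real (Suc j))))"
        by (simp add: powr_minus)
      from mult_left_mono[OF this zero_le_power2[of c]] show ?thesis by (simp only: mult_ac)
    qed
    finally show ?case
      using step.IH by (simp add: algebra_simps)
  qed auto
  show ?thesis
  proof (cases "a \<le> b")
    case True
    have "2 * c\<^sup>2 * (2 powr (- (2 * \<gamma> * real a)) - 2 powr (- (2 * \<gamma> * real b))) \<le>
        2 * c\<^sup>2 * 2 powr (- (2 * \<gamma> * real a))"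
      by (intro mult_left_mono) auto
    with *[OF True] show ?thesis by (simp add: \<gamma>_def)
  next
    case False
    then have "(2::nat) ^ b \<le> 2 ^ a" by (intro power_increasing) auto
    then have "{2 ^ a + 1..2 ^ b :: nat} = {}" by (intro atLeastatMost_empty) linarith
    then show ?thesis by simp
  qed
qed

section \<open>One coordinate of the pivot process\<close>

text \<open>
  With \<open>X = m + v * e\<close> this is one summand of \<open>loss - sure_risk\<close>, compared with \<open>v\<^sup>2 * (1 - e\<^sup>2)\<close>,
  which is its value when \<open>m = 0\<close> and the coordinate is set to 0 by thresholding.
\<close>

definition coordinate_gap :: "real \<Rightarrow> real \<Rightarrow> real \<Rightarrow> real \<Rightarrow> real" where
  "coordinate_gap m v e t =
     (soft_threshold t (m + v * e) - m)\<^sup>2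
     - (v\<^sup>2 - 2 * v\<^sup>2 * of_bool ((m + v * e)\<^sup>2 \<le> t\<^sup>2) + min ((m + v * e)\<^sup>2) (t\<^sup>2))
     - v\<^sup>2 * (1 - e\<^sup>2)"

text \<open>The estimate is 0, so the loss is m^2; the indicator turns v^2 into -v^2, and everything
  except the cross term cancels.\<close>

lemma coordinate_gap_killed:
  assumes "\<bar>m + v * e\<bar> \<le> t"
  shows "coordinate_gap m v e t = - 2 * m * v * e"
proof -
  have "(m + v * e)\<^sup>2 \<le> t\<^sup>2" using assms abs_le_square_iff[of "m + v * e" t] by simp
  then show ?thesis using assms
    by (auto simp: coordinate_gap_def soft_threshold_def min_def power2_eq_square algebra_simps)
qed

text \<open>The loss and the minimum both contain t^2, which cancels; the mean survives only through
  the sign of the observation.\<close>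

lemma coordinate_gap_kept:
  assumes "\<bar>m + v * e\<bar> > t" "t \<ge> 0"
  shows "coordinate_gap m v e t = 2 * v\<^sup>2 * (e\<^sup>2 - 1) - 2 * sgn (m + v * e) * t * v * e"
proof -
  have "\<not> (m + v * e)\<^sup>2 \<le> t\<^sup>2" using assms abs_le_square_iff[of "m + v * e" t] by simp
  then show ?thesis using assms
    by (cases "m + v * e > 0")
      (auto simp: coordinate_gap_def soft_threshold_def min_def power2_eq_square algebra_simps)
qed

lemma abs_le_one_plus_square: "\<bar>e\<bar> \<le> 1 + e\<^sup>2" for e :: real
  using sum_squares_bound[of "\<bar>e\<bar>" 1] by (simp add: power2_eq_square)

text \<open>The bound is free of \<open>m\<close>. A kept coordinate sees the mean only through a
  sign, and a killed one satisfies |m| \<le> t + v|e|, so even its linear term is controlled by the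
  noise.\<close>

lemma abs_coordinate_gap_le:
  assumes "v \<ge> 0" "t \<ge> 0" "t \<le> r * v" "r \<ge> 0"
  shows "\<bar>coordinate_gap m v e t\<bar> \<le> 2 * v\<^sup>2 * (1 + r) * (1 + e\<^sup>2)"
proof -
  have "\<bar>coordinate_gap m v e t\<bar> \<le> 2 * v\<^sup>2 * (1 + e\<^sup>2) + 2 * v\<^sup>2 * r * \<bar>e\<bar>"
  proof (cases "\<bar>m + v * e\<bar> \<le> t")
    case True
    then have "\<bar>m\<bar> \<le> r * v + v * \<bar>e\<bar>"
      using assms abs_triangle_ineq4[of "m + v * e" "v * e"] by (simp add: abs_mult)
    then have "\<bar>m\<bar> * (v * \<bar>e\<bar>) \<le> (r * v + v * \<bar>e\<bar>) * (v * \<bar>e\<bar>)"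
      using assms by (intro mult_right_mono) auto
    also have "\<dots> = v\<^sup>2 * r * \<bar>e\<bar> + v\<^sup>2 * e\<^sup>2"
      by (simp add: power2_eq_square algebra_simps)
    also have "\<dots> \<le> v\<^sup>2 * r * \<bar>e\<bar> + v\<^sup>2 * (1 + e\<^sup>2)"
      by (intro add_left_mono mult_left_mono) auto
    finally show ?thesis
      using coordinate_gap_killed[OF True] assms by (simp add: abs_mult mult_ac)
  next
    case False
    have "\<bar>2 * sgn (m + v * e) * t * v * e\<bar> \<le> 2 * t * v * \<bar>e\<bar>"
      using assms by (simp add: abs_mult abs_sgn_eq)
    also have "\<dots> = 2 * (t * (v * \<bar>e\<bar>))" by simp
    also have "\<dots> \<le> 2 * ((r * v) * (v * \<bar>e\<bar>))"
      using assms by (intro mult_left_mono mult_right_mono) auto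
    finally have 1: "\<bar>2 * sgn (m + v * e) * t * v * e\<bar> \<le> 2 * v\<^sup>2 * r * \<bar>e\<bar>"
      by (simp add: power2_eq_square mult_ac)
    have "\<bar>e\<^sup>2 - 1\<bar> \<le> 1 + e\<^sup>2" by (simp add: abs_le_iff)
    then have "\<bar>2 * v\<^sup>2 * (e\<^sup>2 - 1)\<bar> \<le> 2 * v\<^sup>2 * (1 + e\<^sup>2)"
      unfolding abs_mult by (intro mult_mono) auto
    then show ?thesis
      using 1 coordinate_gap_kept[of t m v e] False assms by linarith
  qed
  also have "\<dots> \<le> 2 * v\<^sup>2 * (1 + e\<^sup>2) + 2 * v\<^sup>2 * r * (1 + e\<^sup>2)"
    using assms by (intro add_left_mono mult_left_mono abs_le_one_plus_square) auto
  finally show ?thesis by (simp add: algebra_simps)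
qed

text \<open>Once the linear term is removed, a killed coordinate contributes nothing. By the
  triangle inequality a small mean survives the threshold only if the noise exceeds
  \<open>(\<rho> - \<delta>) * r\<close>, an event that does not depend on \<open>t\<close>. The
  constant 4 is 2 for the gap plus 2 for the linear term.\<close>

lemma abs_coordinate_gap_plus_le:
  assumes "v > 0" "\<rho> \<ge> 0" "\<rho> * (r * v) \<le> t" "t \<le> r * v" "r \<ge> 0" "\<bar>m\<bar> \<le> \<delta> * (r * v)" "\<delta> \<le> 1"
  shows "\<bar>coordinate_gap m v e t + 2 * m * v * e\<bar> \<le>
           4 * v\<^sup>2 * (1 + r) * ((1 + e\<^sup>2) * of_bool (\<bar>e\<bar> > (\<rho> - \<delta>) * r))"
proof (cases "\<bar>m + v * e\<bar> \<le> t")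
  case True
  then show ?thesis using assms by (simp add: coordinate_gap_killed)
next
  case False
  have t: "t \<ge> 0" using assms by (meson mult_nonneg_nonneg less_imp_le order_trans)
  have "v * ((\<rho> - \<delta>) * r) \<le> t - \<bar>m\<bar>"
    using assms by (simp add: algebra_simps)
  also have "\<dots> < v * \<bar>e\<bar>"
    using False assms abs_triangle_ineq[of m "v * e"] by (simp add: abs_mult)
  finally have e: "\<bar>e\<bar> > (\<rho> - \<delta>) * r" using assms by simp
  have "\<bar>m\<bar> \<le> 1 * (r * v)"
    using assms by (intro order_trans[OF assms(6)] mult_right_mono) auto
  then have "\<bar>2 * m * v * e\<bar> \<le> 2 * (r * v) * v * \<bar>e\<bar>"
    using assms by (simp add: abs_mult mult_right_mono)
  also have "\<dots> = 2 * v\<^sup>2 * r * \<bar>e\<bar>" by (simp add: power2_eq_square)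
  also have "\<dots> \<le> 2 * v\<^sup>2 * (1 + r) * (1 + e\<^sup>2)"
    using assms by (intro mult_mono abs_le_one_plus_square) auto
  finally show ?thesis
    using e abs_coordinate_gap_le[of v t r m e] t assms by simp
qed

text \<open>The right-hand side is free of \<open>u\<close>, so it bounds the supremum over the
  interval. \<open>G\<close> may hold coordinates of any mean, treated by the general gap bound; the
  sharper bound serves the rest. The scale \<open>K\<close> comes from sqrt(n) v^2 = \<sigma>^2 /
  sqrt(n).\<close>

lemma pivot_process_approximation:
  fixes e :: "nat \<Rightarrow> real"
  assumes "n \<ge> 1" "\<sigma> > 0" "0 \<le> \<rho>" "u \<in> {\<rho>..1}" "\<delta> \<le> 1" "G \<subseteq> {1..n}"
    and v: "v = \<sigma> / sqrt (real n)" and r: "r = sqrt (2 * ln (real n))"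
    and x: "\<And>i. i \<in> {1..n} \<Longrightarrow> x i = \<mu> i + v * e i"
    and small: "\<And>i. i \<in> {1..n} - G \<Longrightarrow> \<bar>\<mu> i\<bar> \<le> \<delta> * (r * v)"
    and K: "K = 2 * \<sigma>\<^sup>2 * (1 + r) / sqrt (real n)"
  shows "\<bar>pivot_process {\<rho>..1} \<sigma> n \<mu> x u - \<sigma>\<^sup>2 / sqrt (real n) * (\<Sum>i=1..n. 1 - (e i)\<^sup>2)\<bar> \<le>
           2 * \<sigma> * \<bar>\<Sum>i\<in>{1..n} - G. \<mu> i * e i\<bar> + K * (\<Sum>i\<in>G. 1 + (e i)\<^sup>2)
           + 2 * K * (\<Sum>i\<in>{1..n} - G. (1 + (e i)\<^sup>2) * of_bool (\<bar>e i\<bar> > (\<rho> - \<delta>) * r))"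
proof -
  define t where "t = u * (r * v)"
  have n: "sqrt (real n) > 0" using assms by simp
  have v0: "v > 0" using v n \<open>\<sigma> > 0\<close> by simp
  have r0: "r \<ge> 0" using r \<open>n \<ge> 1\<close> by simp
  have t: "t \<ge> 0" "t \<le> r * v" "\<rho> * (r * v) \<le> t"
    using assms(3,4) v0 r0 by (auto simp: t_def mult_left_le_one_le mult_right_mono)
  have nv: "sqrt (real n) * v = \<sigma>" using v n by simp
  have nv2: "sqrt (real n) * v\<^sup>2 = \<sigma>\<^sup>2 / sqrt (real n)"
    using v n by (simp add: power2_eq_square field_simps)
  have v2: "v\<^sup>2 = \<sigma>\<^sup>2 / real n"
    using v by (simp add: power_divide)
  define g where "g i = coordinate_gap (\<mu> i) v (e i) t" for i
  define H where "H = {1..n} - G"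
  have fin: "finite G" "finite H" and disj: "G \<inter> H = {}" "G \<union> H = {1..n}"
    using assms(6) finite_subset by (auto simp: H_def)
  have "threshold_scale \<sigma> n = r * v" by (simp add: threshold_scale_def r v)
  then have "pivot_process {\<rho>..1} \<sigma> n \<mu> x u - \<sigma>\<^sup>2 / sqrt (real n) * (\<Sum>i=1..n. 1 - (e i)\<^sup>2) =
      sqrt (real n) * (loss n \<mu> x t - sure_risk \<sigma> n x t - v\<^sup>2 * (\<Sum>i=1..n. 1 - (e i)\<^sup>2))"
    using \<open>u \<in> _\<close> by (simp add: pivot_process_def t_def right_diff_distrib mult.assoc nv2[symmetric])
  also have "loss n \<mu> x t - sure_risk \<sigma> n x t - v\<^sup>2 * (\<Sum>i=1..n. 1 - (e i)\<^sup>2) = (\<Sum>i=1..n. g i)"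
    unfolding loss_def sure_risk_def sum_distrib_left sum_subtractf[symmetric] g_def coordinate_gap_def v2
    by (intro sum.cong refl) (simp add: x v2)
  also have "(\<Sum>i=1..n. g i) = (\<Sum>i\<in>G. g i) + (\<Sum>i\<in>H. g i)"
    using disj fin by (metis sum.union_disjoint)
  \<comment> \<open>The linear terms stay together with their signs: the smallness of their sum
    comes from cancellation among independent noises, measured later by its variance.\<close>
  also have "(\<Sum>i\<in>H. g i) = (\<Sum>i\<in>H. g i + 2 * \<mu> i * v * e i) - 2 * v * (\<Sum>i\<in>H. \<mu> i * e i)"
    by (simp add: sum.distrib sum_distrib_left mult_ac)
  also have "\<bar>sqrt (real n) * ((\<Sum>i\<in>G. g i) + \<dots>)\<bar> \<le>
      sqrt (real n) * (\<Sum>i\<in>G. \<bar>g i\<bar>) + sqrt (real n) * (\<Sum>i\<in>H. \<bar>g i + 2 * \<mu> i * v * e i\<bar>)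
      + sqrt (real n) * (2 * v * \<bar>\<Sum>i\<in>H. \<mu> i * e i\<bar>)"
  proof -
    have "\<bar>(\<Sum>i\<in>G. g i) + ((\<Sum>i\<in>H. g i + 2 * \<mu> i * v * e i) - 2 * v * (\<Sum>i\<in>H. \<mu> i * e i))\<bar> \<le>
      \<bar>\<Sum>i\<in>G. g i\<bar> + \<bar>\<Sum>i\<in>H. g i + 2 * \<mu> i * v * e i\<bar> + \<bar>2 * v * (\<Sum>i\<in>H. \<mu> i * e i)\<bar>"
      by linarith
    also have "\<dots> \<le> (\<Sum>i\<in>G. \<bar>g i\<bar>) + (\<Sum>i\<in>H. \<bar>g i + 2 * \<mu> i * v * e i\<bar>) + 2 * v * \<bar>\<Sum>i\<in>H. \<mu> i * e i\<bar>"
      using v0 by (intro add_mono sum_abs) (simp add: abs_mult)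
    finally show ?thesis using n by (simp add: abs_mult distrib_left[symmetric])
  qed
  also have "\<dots> \<le> sqrt (real n) * (\<Sum>i\<in>G. 2 * v\<^sup>2 * (1 + r) * (1 + (e i)\<^sup>2))
      + sqrt (real n) * (\<Sum>i\<in>H. 4 * v\<^sup>2 * (1 + r) * ((1 + (e i)\<^sup>2) * of_bool (\<bar>e i\<bar> > (\<rho> - \<delta>) * r)))
      + sqrt (real n) * (2 * v * \<bar>\<Sum>i\<in>H. \<mu> i * e i\<bar>)"
    using n v0 t r0 assms(3,5) small unfolding g_def
    by (intro add_mono mult_left_mono sum_mono abs_coordinate_gap_le abs_coordinate_gap_plus_le)
      (auto simp: H_def)
  also have "\<dots> = 2 * (sqrt (real n) * v\<^sup>2) * (1 + r) * (\<Sum>i\<in>G. 1 + (e i)\<^sup>2)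
      + 4 * (sqrt (real n) * v\<^sup>2) * (1 + r) * (\<Sum>i\<in>H. (1 + (e i)\<^sup>2) * of_bool (\<bar>e i\<bar> > (\<rho> - \<delta>) * r))
      + 2 * (sqrt (real n) * v) * \<bar>\<Sum>i\<in>H. \<mu> i * e i\<bar>"
    unfolding sum_distrib_left[symmetric] by (simp add: mult_ac)
  finally show ?thesis
    unfolding nv nv2 K H_def by simp
qed

section \<open>Gaussian moments\<close>

text \<open>Tilting the standard normal density by exp(\<theta> x^2 / 2) gives a multiple of a
  centred normal density of variance 1/(1 - \<theta>), whose moments are finite.\<close>

lemma std_normal_exp_square_integrable:
  assumes "\<theta> < 1"
  shows "integrable lborel (\<lambda>x. std_normal_density x * ((1 + x\<^sup>2) * exp (\<theta> * x\<^sup>2 / 2)))"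
proof -
  define w where "w = 1 / sqrt (1 - \<theta>)"
  have w: "w > 0" "w\<^sup>2 = 1 / (1 - \<theta>)"
    using assms by (simp_all add: w_def power_divide)
  have "std_normal_density x * ((1 + x\<^sup>2) * exp (\<theta> * x\<^sup>2 / 2)) =
      w * (normal_density 0 w x * (x - 0) ^ 0 + normal_density 0 w x * (x - 0)\<^sup>2)" for x
  proof -
    have "- x\<^sup>2 / 2 + \<theta> * x\<^sup>2 / 2 = - x\<^sup>2 / (2 * w\<^sup>2)"
      by (simp add: w(2) algebra_simps diff_divide_distrib)
    then have "exp (- x\<^sup>2 / 2) * exp (\<theta> * x\<^sup>2 / 2) = exp (- x\<^sup>2 / (2 * w\<^sup>2))"
      by (metis exp_add)
    moreover have "w * (1 / sqrt (2 * pi * w\<^sup>2)) = 1 / sqrt (2 * pi)"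
      using w(1) by (simp add: real_sqrt_mult)
    moreover have "w * normal_density 0 w x = (w * (1 / sqrt (2 * pi * w\<^sup>2))) * exp (- x\<^sup>2 / (2 * w\<^sup>2))"
      by (simp add: normal_density_def)
    moreover have "std_normal_density x * exp (\<theta> * x\<^sup>2 / 2) =
        1 / sqrt (2 * pi) * (exp (- x\<^sup>2 / 2) * exp (\<theta> * x\<^sup>2 / 2))"
      by (simp add: std_normal_density_def)
    ultimately have *: "std_normal_density x * exp (\<theta> * x\<^sup>2 / 2) = w * normal_density 0 w x"
      by simp
    have "std_normal_density x * ((1 + x\<^sup>2) * exp (\<theta> * x\<^sup>2 / 2)) =
        (1 + x\<^sup>2) * (std_normal_density x * exp (\<theta> * x\<^sup>2 / 2))"
      by simp
    also have "\<dots> = w * (normal_density 0 w x * (x - 0) ^ 0 + normal_density 0 w x * (x - 0)\<^sup>2)"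
      unfolding * by (simp add: algebra_simps)
    finally show ?thesis .
  qed
  moreover have "integrable lborel
      (\<lambda>x. w * (normal_density 0 w x * (x - 0) ^ 0 + normal_density 0 w x * (x - 0)\<^sup>2))"
    using w by (intro integrable_mult_right Bochner_Integration.integrable_add integrable_normal_moment)
  ultimately show ?thesis by simp
qed

text \<open>The constant in the exponential Markov bound for truncated second moments below.\<close>

definition std_normal_exp_square :: "real \<Rightarrow> real" where
  "std_normal_exp_square \<theta> =
     (\<integral>x. std_normal_density x * ((1 + x\<^sup>2) * exp (\<theta> * x\<^sup>2 / 2)) \<partial>lborel)"

lemma std_normal_exp_square_nonneg: "std_normal_exp_square \<theta> \<ge> 0"
  unfolding std_normal_exp_square_def by (intro integral_nonneg_AE) auto

context prob_space
begin

section \<open>Square, truncated and weighted moments of standard normal noise\<close>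

lemma std_normal_distributed_measurable:
  "distributed M lborel e std_normal_density \<Longrightarrow> e \<in> borel_measurable M"
  using distributed_measurable by fastforce

lemma std_normal_integrable_square:
  assumes "distributed M lborel e std_normal_density"
  shows "integrable M (\<lambda>\<omega>. (e \<omega>)\<^sup>2)"
  using distributed_integrable[OF assms, of "\<lambda>x. x\<^sup>2"] integrable_std_normal_moment[of 2] by simp

lemma std_normal_expectation_square:
  assumes "distributed M lborel e std_normal_density"
  shows "expectation (\<lambda>\<omega>. (e \<omega>)\<^sup>2) = 1"
  using standard_normal_distributed_variance[OF assms]
  by (simp add: standard_normal_distributed_expectation[OF assms])

text \<open>Exponential Markov inequality: the indicator of |e| > a is at most exp(\<theta> (e^2 -
  a^2) / 2). The rate \<theta> stays free, to be taken close enough to 1 later.\<close>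

lemma std_normal_truncated_square:
  assumes e: "distributed M lborel e std_normal_density" and "\<theta> < 1" "0 \<le> \<theta>" "a \<ge> 0"
  shows "integrable M (\<lambda>\<omega>. (1 + (e \<omega>)\<^sup>2) * of_bool (\<bar>e \<omega>\<bar> > a))" (is ?int)
    and "expectation (\<lambda>\<omega>. (1 + (e \<omega>)\<^sup>2) * of_bool (\<bar>e \<omega>\<bar> > a)) \<le>
           std_normal_exp_square \<theta> * exp (- \<theta> * a\<^sup>2 / 2)" (is ?le)
proof -
  have [measurable]: "e \<in> borel_measurable M"
    by (rule std_normal_distributed_measurable[OF e])
  show int: ?int
  proof (rule Bochner_Integration.integrable_bound)
    show "integrable M (\<lambda>\<omega>. 1 + (e \<omega>)\<^sup>2)"
      using std_normal_integrable_square[OF e] by simp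
    show "AE \<omega> in M. norm ((1 + (e \<omega>)\<^sup>2) * of_bool (\<bar>e \<omega>\<bar> > a)) \<le> norm (1 + (e \<omega>)\<^sup>2)"
      by (rule AE_I2) (simp add: of_bool_def)
  qed measurable
  have int': "integrable M (\<lambda>\<omega>. (1 + (e \<omega>)\<^sup>2) * exp (\<theta> * (e \<omega>)\<^sup>2 / 2))"
    using distributed_integrable[OF e, of "\<lambda>x. (1 + x\<^sup>2) * exp (\<theta> * x\<^sup>2 / 2)"]
      std_normal_exp_square_integrable[OF \<open>\<theta> < 1\<close>] by simp
  have "expectation (\<lambda>\<omega>. (1 + (e \<omega>)\<^sup>2) * of_bool (\<bar>e \<omega>\<bar> > a)) \<le>
      expectation (\<lambda>\<omega>. (1 + (e \<omega>)\<^sup>2) * exp (\<theta> * (e \<omega>)\<^sup>2 / 2) * exp (- \<theta> * a\<^sup>2 / 2))"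
  proof (intro integral_mono int integrable_mult_left int')
    fix \<omega>
    have "of_bool (\<bar>e \<omega>\<bar> > a) \<le> exp (\<theta> * (e \<omega>)\<^sup>2 / 2 + - \<theta> * a\<^sup>2 / 2)"
    proof (cases "\<bar>e \<omega>\<bar> > a")
      case True
      then have "a\<^sup>2 \<le> (e \<omega>)\<^sup>2" using \<open>a \<ge> 0\<close> by (metis abs_le_square_iff abs_of_nonneg less_imp_le)
      then show ?thesis using \<open>0 \<le> \<theta>\<close> by (simp add: mult_left_mono)
    qed simp
    then show "(1 + (e \<omega>)\<^sup>2) * of_bool (\<bar>e \<omega>\<bar> > a) \<le>
        (1 + (e \<omega>)\<^sup>2) * exp (\<theta> * (e \<omega>)\<^sup>2 / 2) * exp (- \<theta> * a\<^sup>2 / 2)"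
      unfolding exp_add mult.assoc by (intro mult_left_mono) auto
  qed
  also have "\<dots> = expectation (\<lambda>\<omega>. (1 + (e \<omega>)\<^sup>2) * exp (\<theta> * (e \<omega>)\<^sup>2 / 2)) * exp (- \<theta> * a\<^sup>2 / 2)"
    by simp
  also have "expectation (\<lambda>\<omega>. (1 + (e \<omega>)\<^sup>2) * exp (\<theta> * (e \<omega>)\<^sup>2 / 2)) = std_normal_exp_square \<theta>"
    unfolding std_normal_exp_square_def
    using distributed_integral[OF e, of "\<lambda>x. (1 + x\<^sup>2) * exp (\<theta> * x\<^sup>2 / 2)"] by simp
  finally show ?le .
qed

text \<open>The sum is centred normal with variance \<tau>^2, the sum of the squared weights, and
  its absolute mean is \<tau> sqrt(2/pi), which is at most \<tau>.\<close>

lemma std_normal_weighted_sum: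
  fixes w :: "'i \<Rightarrow> real"
  assumes fin: "finite I" and ind: "indep_vars (\<lambda>_. borel) e I"
    and e: "\<And>i. i \<in> I \<Longrightarrow> distributed M lborel (e i) std_normal_density"
  shows "integrable M (\<lambda>\<omega>. \<bar>\<Sum>i\<in>I. w i * e i \<omega>\<bar>)" (is ?int)
    and "expectation (\<lambda>\<omega>. \<bar>\<Sum>i\<in>I. w i * e i \<omega>\<bar>) \<le> sqrt (\<Sum>i\<in>I. (w i)\<^sup>2)" (is ?le)
proof -
  \<comment> \<open>Zero weights are dropped because a degenerate normal summand has no
    density.\<close>
  define J where "J = {i \<in> I. w i \<noteq> 0}"
  have J: "finite J" "J \<subseteq> I" using fin by (auto simp: J_def)
  define S where "S \<omega> = (\<Sum>i\<in>J. w i * e i \<omega>)" for \<omega>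
  define \<tau> where "\<tau> = sqrt (\<Sum>i\<in>J. \<bar>w i\<bar>\<^sup>2)"
  have "(\<Sum>i\<in>I. w i * e i \<omega>) = S \<omega>" for \<omega>
    unfolding S_def using fin by (intro sum.mono_neutral_right) (auto simp: J_def)
  moreover have "sqrt (\<Sum>i\<in>I. (w i)\<^sup>2) = \<tau>"
    unfolding \<tau>_def using fin by (auto intro!: sum.mono_neutral_right simp: J_def)
  moreover have "integrable M (\<lambda>\<omega>. \<bar>S \<omega>\<bar>) \<and> expectation (\<lambda>\<omega>. \<bar>S \<omega>\<bar>) \<le> \<tau>"
  proof (cases "J = {}")
    case True
    then show ?thesis by (simp add: S_def \<tau>_def)
  next
    case False
    have "(\<Sum>i\<in>J. \<bar>w i\<bar>\<^sup>2) > 0"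
      using J(1) False by (intro sum_pos) (auto simp: J_def)
    then have "\<tau> > 0" by (simp add: \<tau>_def)
    have "distributed M lborel (\<lambda>\<omega>. \<Sum>i\<in>J. w i * e i \<omega>) (normal_density (\<Sum>i\<in>J. 0) \<tau>)"
      unfolding \<tau>_def
    proof (rule sum_indep_normal[OF J(1) False])
      show "indep_vars (\<lambda>_. borel) (\<lambda>i \<omega>. w i * e i \<omega>) J"
        by (rule indep_vars_compose2[where Y = "\<lambda>i x. w i * x", OF indep_vars_subset[OF ind J(2)]]) auto
      fix i assume i: "i \<in> J"
      show "\<bar>w i\<bar> > 0" using i by (simp add: J_def)
      show "distributed M lborel (\<lambda>\<omega>. w i * e i \<omega>) (normal_density 0 \<bar>w i\<bar>)"
        using normal_density_affine[of "e i" 0 1 "w i" 0] e[of i] i J by (auto simp: J_def)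
    qed
    then have S: "distributed M lborel S (normal_density 0 \<tau>)"
      unfolding S_def by simp
    have "integrable lborel (\<lambda>x. normal_density 0 \<tau> x * \<bar>x\<bar>)"
      using integrable_normal_moment_abs[OF \<open>\<tau> > 0\<close>, of 0 1] by simp
    then have "integrable M (\<lambda>\<omega>. \<bar>S \<omega>\<bar>)"
      using distributed_integrable[OF S, of abs] by simp
    moreover have "expectation (\<lambda>\<omega>. \<bar>S \<omega>\<bar>) = \<tau> * sqrt (2 / pi)"
      using distributed_integral[OF S, of abs] integral_normal_moment_abs_odd[OF \<open>\<tau> > 0\<close>, of 0 0]
      by simp
    moreover have "sqrt (2 / pi) \<le> 1" using pi_gt3 by simp
    ultimately show ?thesis using \<open>\<tau> > 0\<close> by simp
  qed
  ultimately show ?int ?le by simp_all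
qed

text \<open>Takes expectations in the pathwise bound on the pivot process term by term; each
  \<open>1 + e^2\<close> has mean 2.\<close>

lemma remainder_expectation_le:
  fixes e :: "nat \<Rightarrow> 'a \<Rightarrow> real" and \<mu> :: "nat \<Rightarrow> real" and K \<sigma> \<theta> a :: real
  assumes ind: "indep_vars (\<lambda>_. borel) e {1..n}"
    and e: "\<And>i. i \<in> {1..n} \<Longrightarrow> distributed M lborel (e i) std_normal_density"
    and G: "G \<subseteq> {1..n}" and "K \<ge> 0" "\<sigma> > 0" "0 \<le> \<theta>" "\<theta> < 1" "a \<ge> 0"
  defines "R \<equiv> \<lambda>\<omega>. 2 * \<sigma> * \<bar>\<Sum>i\<in>{1..n} - G. \<mu> i * e i \<omega>\<bar> + K * (\<Sum>i\<in>G. 1 + (e i \<omega>)\<^sup>2)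
           + 2 * K * (\<Sum>i\<in>{1..n} - G. (1 + (e i \<omega>)\<^sup>2) * of_bool (\<bar>e i \<omega>\<bar> > a))"
  shows "integrable M R"
    and "expectation R \<le> 2 * \<sigma> * sqrt (\<Sum>i\<in>{1..n} - G. (\<mu> i)\<^sup>2) + 2 * K * card G
           + 2 * K * (n * (std_normal_exp_square \<theta> * exp (- \<theta> * a\<^sup>2 / 2)))"
proof -
  have fin: "finite G" "finite ({1..n} - G)" using G finite_subset by auto
  have ind': "indep_vars (\<lambda>_. borel) e ({1..n} - G)"
    by (rule indep_vars_subset[OF ind]) auto
  define S where "S \<omega> = \<bar>\<Sum>i\<in>{1..n} - G. \<mu> i * e i \<omega>\<bar>" for \<omega>
  define V where "V \<omega> = (\<Sum>i\<in>G. 1 + (e i \<omega>)\<^sup>2)" for \<omega>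
  define U where "U \<omega> = (\<Sum>i\<in>{1..n} - G. (1 + (e i \<omega>)\<^sup>2) * of_bool (\<bar>e i \<omega>\<bar> > a))" for \<omega>
  have R: "R = (\<lambda>\<omega>. 2 * \<sigma> * S \<omega> + K * V \<omega> + 2 * K * U \<omega>)"
    by (simp add: R_def S_def V_def U_def)
  have S: "integrable M S" "expectation S \<le> sqrt (\<Sum>i\<in>{1..n} - G. (\<mu> i)\<^sup>2)"
    unfolding S_def[abs_def] by (intro std_normal_weighted_sum[OF fin(2) ind'] e; simp)+
  have sq: "i \<in> G \<Longrightarrow> integrable M (\<lambda>\<omega>. (e i \<omega>)\<^sup>2)" for i
    using G by (intro std_normal_integrable_square e) auto
  have V: "integrable M V" "expectation V = 2 * card G"
  proof -
    show "integrable M V"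
      unfolding V_def[abs_def] using sq by (intro Bochner_Integration.integrable_sum Bochner_Integration.integrable_add) auto
    have "expectation V = (\<Sum>i\<in>G. expectation (\<lambda>\<omega>. 1 + (e i \<omega>)\<^sup>2))"
      unfolding V_def[abs_def] using sq by (intro Bochner_Integration.integral_sum) auto
    also have "\<dots> = (\<Sum>i\<in>G. 2)"
    proof (rule sum.cong[OF refl])
      fix i assume "i \<in> G"
      then show "expectation (\<lambda>\<omega>. 1 + (e i \<omega>)\<^sup>2) = 2"
        using sq std_normal_expectation_square[OF e, of i] G prob_space by (subst Bochner_Integration.integral_add) auto
    qed
    finally show "expectation V = 2 * card G" by simp
  qed
  have trunc: "integrable M (\<lambda>\<omega>. (1 + (e i \<omega>)\<^sup>2) * of_bool (\<bar>e i \<omega>\<bar> > a))"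
    "expectation (\<lambda>\<omega>. (1 + (e i \<omega>)\<^sup>2) * of_bool (\<bar>e i \<omega>\<bar> > a)) \<le>
           std_normal_exp_square \<theta> * exp (- \<theta> * a\<^sup>2 / 2)" if "i \<in> {1..n} - G" for i
    using that assms by (intro std_normal_truncated_square[OF e]; simp)+
  have U: "integrable M U" "expectation U \<le> n * (std_normal_exp_square \<theta> * exp (- \<theta> * a\<^sup>2 / 2))"
  proof -
    show "integrable M U"
      unfolding U_def[abs_def] by (intro Bochner_Integration.integrable_sum trunc)
    have "expectation U = (\<Sum>i\<in>{1..n} - G. expectation (\<lambda>\<omega>. (1 + (e i \<omega>)\<^sup>2) * of_bool (\<bar>e i \<omega>\<bar> > a)))"
      unfolding U_def[abs_def] by (intro Bochner_Integration.integral_sum trunc)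
    also have "\<dots> \<le> (\<Sum>i\<in>{1..n} - G. std_normal_exp_square \<theta> * exp (- \<theta> * a\<^sup>2 / 2))"
      by (intro sum_mono trunc)
    \<comment> \<open>Enlarging the index set to all \<open>n\<close> coordinates is affordable: in
      the application the exponential factor is a power of \<open>n\<close> with exponent below
      -1/2.\<close>
    also have "\<dots> \<le> (\<Sum>i\<in>{1..n}. std_normal_exp_square \<theta> * exp (- \<theta> * a\<^sup>2 / 2))"
      by (intro sum_mono2) (auto simp: std_normal_exp_square_nonneg)
    finally show "expectation U \<le> n * (std_normal_exp_square \<theta> * exp (- \<theta> * a\<^sup>2 / 2))" by simp
  qed
  show "integrable M R"
    unfolding R using S V U by (intro Bochner_Integration.integrable_add integrable_mult_right)
  have "expectation R = 2 * \<sigma> * expectation S + K * expectation V + 2 * K * expectation U"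
    unfolding R using S V U by simp
  also have "\<dots> \<le> 2 * \<sigma> * sqrt (\<Sum>i\<in>{1..n} - G. (\<mu> i)\<^sup>2) + K * (2 * card G)
           + 2 * K * (n * (std_normal_exp_square \<theta> * exp (- \<theta> * a\<^sup>2 / 2)))"
    using S U V assms by (intro add_mono mult_left_mono) auto
  finally show "expectation R \<le> 2 * \<sigma> * sqrt (\<Sum>i\<in>{1..n} - G. (\<mu> i)\<^sup>2) + 2 * K * card G
           + 2 * K * (n * (std_normal_exp_square \<theta> * exp (- \<theta> * a\<^sup>2 / 2)))" by simp
qed

end

section \<open>Approximation of the pivot process by a random constant\<close>

lemma log_factor_tendsto_0:
  assumes "b < (1/2::real)"
  shows "(\<lambda>n. (1 + sqrt (2 * ln (real n))) / sqrt (real n) * real n powr b) \<longlonglongrightarrow> 0"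
  using assms by real_asymp

lemma powr_neg_tendsto_0:
  assumes "b > (0::real)"
  shows "(\<lambda>n. real n powr - b) \<longlonglongrightarrow> 0"
  using assms by real_asymp

text \<open>
  In the application \<open>n powr a\<close> bounds the number of coordinates of low resolution, \<open>A * n powr (- b)\<close>
  the energy of the others, \<open>A * C * n powr (1 - b)\<close> the number of those above a fraction of the
  threshold, and \<open>C * n powr (1 - d)\<close> the contribution of small coordinates that survive thresholding.
\<close>

definition approximation_rate :: "real \<Rightarrow> real \<Rightarrow> real \<Rightarrow> real \<Rightarrow> real \<Rightarrow> real \<Rightarrow> nat \<Rightarrow> real" where
  "approximation_rate \<sigma> A C a b d n =
     2 * \<sigma> * sqrt (A * real n powr (- b)) +
     2 * (2 * \<sigma>\<^sup>2 * (1 + sqrt (2 * ln (real n))) / sqrt (real n)) *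
       (real n powr a + A * C * real n powr (1 - b) + C * real n powr (1 - d))"

lemma approximation_rate_tendsto_0:
  assumes "a < 1/2" "b > 1/2" "d > 1/2"
  shows "approximation_rate \<sigma> A C a b d \<longlonglongrightarrow> 0"
proof -
  let ?L = "\<lambda>n. (1 + sqrt (2 * ln (real n))) / sqrt (real n)"
  have "(\<lambda>n. 2 * \<sigma> * sqrt (A * real n powr (- b)) + (4 * \<sigma>\<^sup>2) * (?L n * real n powr a)
      + (4 * \<sigma>\<^sup>2 * A * C) * (?L n * real n powr (1 - b))
      + (4 * \<sigma>\<^sup>2 * C) * (?L n * real n powr (1 - d))) \<longlonglongrightarrow>
      2 * \<sigma> * sqrt (A * 0) + (4 * \<sigma>\<^sup>2) * 0 + (4 * \<sigma>\<^sup>2 * A * C) * 0 + (4 * \<sigma>\<^sup>2 * C) * 0"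
    using assms by (intro tendsto_intros log_factor_tendsto_0 powr_neg_tendsto_0) auto
  then show ?thesis
    by (simp add: approximation_rate_def[abs_def] algebra_simps add_divide_distrib)
qed

text \<open>Chebyshev's inequality for counting measure.\<close>

lemma card_large_le:
  fixes f :: "'a \<Rightarrow> real"
  assumes "finite A" "\<eta> > 0"
  shows "real (card {i \<in> A. \<bar>f i\<bar> > \<eta>}) \<le> (\<Sum>i\<in>A. (f i)\<^sup>2) / \<eta>\<^sup>2"
proof -
  have "real (card {i \<in> A. \<bar>f i\<bar> > \<eta>}) * \<eta>\<^sup>2 = (\<Sum>i\<in>{i \<in> A. \<bar>f i\<bar> > \<eta>}. \<eta>\<^sup>2)"
    by simp
  also have "\<dots> \<le> (\<Sum>i\<in>{i \<in> A. \<bar>f i\<bar> > \<eta>}. (f i)\<^sup>2)"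
    using \<open>\<eta> > 0\<close> by (intro sum_mono) (auto simp flip: abs_le_square_iff)
  also have "\<dots> \<le> (\<Sum>i\<in>A. (f i)\<^sup>2)"
    using \<open>finite A\<close> by (intro sum_mono2) auto
  finally show ?thesis using \<open>\<eta> > 0\<close> by (simp add: pos_le_divide_eq)
qed

lemma sequence_model_std_normal:
  assumes "sequence_model \<sigma> n \<mu> M X" "\<sigma> > 0" "n \<ge> 1"
  defines "e \<equiv> \<lambda>i \<omega>. (X i \<omega> - \<mu> i) / (\<sigma> / sqrt (real n))"
  shows "prob_space M" "prob_space.indep_vars M (\<lambda>_. borel) e {1..n}"
    and "\<And>i. i \<in> {1..n} \<Longrightarrow> distributed M lborel (e i) std_normal_density"
proof -
  show ps: "prob_space M" using assms by (simp add: sequence_model_def)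
  interpret prob_space M by (rule ps)
  show "indep_vars (\<lambda>_. borel) e {1..n}"
    unfolding e_def using assms
    by (intro indep_vars_compose2[where X = X and Y = "\<lambda>i x. (x - \<mu> i) / (\<sigma> / sqrt (real n))"])
      (auto simp: sequence_model_def)
  show "distributed M lborel (e i) std_normal_density" if "i \<in> {1..n}" for i
    unfolding e_def using assms that
    by (subst normal_standard_normal_convert[symmetric]) (auto simp: sequence_model_def)
qed

text \<open>Uniformity over the body lies in the order of choice: \<open>B\<close> comes before
  \<open>\<mu>\<close>, \<open>M\<close> and \<open>X\<close>. The error is dominated pathwise by an
  integrable \<open>R\<close>, which avoids asking for measurability of a supremum over
  \<open>u\<close>.\<close>

lemma pivot_process_uniform_approximation:
  fixes J0 :: nat and p q s c \<sigma> \<rho> :: real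
  assumes pq: "p \<ge> 1" "q \<ge> 1" and \<gamma>: "besov_gamma p s > 1/2" and "c > 0"
    and \<rho>: "1 / sqrt 2 < \<rho>" "\<rho> < 1" and "\<sigma> > 0"
  obtains B where "B \<longlonglongrightarrow> 0"
    and "\<forall>\<^sub>F J1 in sequentially. \<forall>n \<mu> (M :: 'w measure) X.
           n = 2 ^ (J1 + 1) \<longrightarrow> \<mu> \<in> besov_body J0 p q s c \<longrightarrow> sequence_model \<sigma> n \<mu> M X \<longrightarrow>
           (\<exists>R. integrable M R \<and> integral\<^sup>L M R \<le> B J1 \<and>
              (\<forall>\<omega>. \<forall>u\<in>{\<rho>..1}. \<bar>pivot_process {\<rho>..1} \<sigma> n \<mu> (\<lambda>i. X i \<omega>) u -
                 \<sigma>\<^sup>2 / sqrt (real n) * (\<Sum>i=1..n. 1 - ((X i \<omega> - \<mu> i) / (\<sigma> / sqrt (real n)))\<^sup>2)\<bar> \<le> R \<omega>))"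
proof -
  define g where "g = besov_gamma p s"
  have g: "g > 1/2" using \<gamma> by (simp add: g_def)
  \<comment> \<open>Half the distance from \<open>\<rho>\<close> to 1/sqrt 2, so that
    \<open>\<kappa> = \<rho> - \<delta>\<close> still exceeds 1/sqrt 2.\<close>
  define \<delta> where "\<delta> = (\<rho> - 1 / sqrt 2) / 2"
  define \<kappa> where "\<kappa> = \<rho> - \<delta>"
  have \<delta>: "\<delta> > 0" "\<delta> \<le> 1" and \<kappa>: "\<kappa> > 1 / sqrt 2" and \<rho>0: "\<rho> \<ge> 0"
  proof -
    have "1 / sqrt 2 > (0::real)" by simp
    then show "\<delta> > 0" "\<delta> \<le> 1" "\<kappa> > 1 / sqrt 2" "\<rho> \<ge> 0"
      using \<rho> unfolding \<delta>_def \<kappa>_def by argo+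
  qed
  have \<kappa>0: "\<kappa> > 0" using \<kappa> by (meson divide_pos_pos less_trans real_sqrt_gt_0_iff zero_less_numeral zero_less_one)
  have \<kappa>2: "\<kappa>\<^sup>2 > 1/2"
    using power_strict_mono[OF \<kappa>, of 2] by (simp add: power_divide)
  \<comment> \<open>Makes \<open>\<theta> * \<kappa>^2\<close> the midpoint of 1/2 and
    \<open>\<kappa>^2\<close>: this keeps \<open>\<theta>\<close> below 1 and the exponent
    \<open>1 - \<theta> * \<kappa>^2\<close> below 1/2.\<close>
  define \<theta> where "\<theta> = (1/2 + \<kappa>\<^sup>2) / 2 / \<kappa>\<^sup>2"
  have \<theta>\<kappa>: "\<theta> * \<kappa>\<^sup>2 = (1/2 + \<kappa>\<^sup>2) / 2" using \<kappa>0 by (simp add: \<theta>_def)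
  have \<theta>: "\<theta> < 1" "\<theta> \<ge> 0" using \<kappa>2 \<kappa>0 by (auto simp: \<theta>_def field_simps)
  \<comment> \<open>The midpoint of the admissible range: \<open>a < 1/2\<close> leaves few
    low-resolution coordinates, and \<open>2 * g * a > 1/2\<close> makes the tail energy small
    enough to count the large coefficients.\<close>
  define a where "a = (1 / (4 * g) + 1/2) / 2"
  have a: "a < 1/2" "a > 0" "2 * g * a > 1/2"
    using g by (auto simp: a_def field_simps)
  \<comment> \<open>The factor \<open>2 powr (2 * g)\<close> pays for rounding the cut level down to
    an integer. \<open>C\<close> below serves both the count of large coefficients and the truncated
    moments.\<close>
  define A where "A = 2 * c\<^sup>2 * 2 powr (2 * g)"
  define C where "C = max (1 / (\<delta>\<^sup>2 * \<sigma>\<^sup>2)) (std_normal_exp_square \<theta>)"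
  have A0: "A \<ge> 0" by (simp add: A_def)
  have C0: "C \<ge> 0" using std_normal_exp_square_nonneg[of \<theta>] by (simp add: C_def le_max_iff_disj)
  define B where "B J1 = approximation_rate \<sigma> A C a (2 * g * a) (\<theta> * \<kappa>\<^sup>2) (2 ^ (J1 + 1))" for J1 :: nat
  have "filterlim (\<lambda>J1::nat. (2::nat) ^ (J1 + 1)) at_top sequentially"
    by (intro filterlim_compose[OF _ filterlim_add_const_nat_at_top]) 
       (simp add: filterlim_subseq strict_mono_def)
  then have B: "B \<longlonglongrightarrow> 0"
    unfolding B_def[abs_def] using a \<theta>\<kappa> \<kappa>2
    by (intro filterlim_compose[OF approximation_rate_tendsto_0]) auto
  \<comment> \<open>The cut level, the integer part of a log2(n). The tail bound applies from level
    \<open>J0\<close> on, so the estimate holds only for large \<open>J1\<close>.\<close>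
  define j where "j J1 = nat \<lfloor>a * real (J1 + 1)\<rfloor>" for J1 :: nat
  have "\<forall>\<^sub>F J1 in sequentially. j J1 \<ge> J0"
  proof -
    have "filterlim (\<lambda>J1. a * real (J1 + 1)) at_top sequentially"
      using a by real_asymp
    then have "\<forall>\<^sub>F J1 in sequentially. real J0 \<le> a * real (J1 + 1)"
      by (simp add: filterlim_at_top)
    then show ?thesis
      by (rule eventually_mono) (simp only: j_def le_nat_floor)
  qed
  then have "\<forall>\<^sub>F J1 in sequentially. \<forall>n \<mu> (M :: 'w measure) X.
           n = 2 ^ (J1 + 1) \<longrightarrow> \<mu> \<in> besov_body J0 p q s c \<longrightarrow> sequence_model \<sigma> n \<mu> M X \<longrightarrow>
           (\<exists>R. integrable M R \<and> integral\<^sup>L M R \<le> B J1 \<and>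
              (\<forall>\<omega>. \<forall>u\<in>{\<rho>..1}. \<bar>pivot_process {\<rho>..1} \<sigma> n \<mu> (\<lambda>i. X i \<omega>) u -
                 \<sigma>\<^sup>2 / sqrt (real n) * (\<Sum>i=1..n. 1 - ((X i \<omega> - \<mu> i) / (\<sigma> / sqrt (real n)))\<^sup>2)\<bar> \<le> R \<omega>))"
  proof (rule eventually_mono, intro allI impI)
    fix J1 n :: nat and \<mu> and M :: "'w measure" and X
    assume J: "j J1 \<ge> J0" and n: "n = 2 ^ (J1 + 1)" and \<mu>: "\<mu> \<in> besov_body J0 p q s c"
      and sm: "sequence_model \<sigma> n \<mu> M X"
    have n1: "n \<ge> 2" using n by simp
    define v where "v = \<sigma> / sqrt (real n)"
    define r where "r = sqrt (2 * ln (real n))"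
    define K where "K = 2 * \<sigma>\<^sup>2 * (1 + r) / sqrt (real n)"
    define e where "e i \<omega> = (X i \<omega> - \<mu> i) / v" for i \<omega>
    have v: "v > 0" using n1 \<open>\<sigma> > 0\<close> by (simp add: v_def)
    have "ln 2 \<le> ln (real n)" using n1 by simp
    then have "2 * ln (real n) \<ge> 1" using ln2_ge_two_thirds by linarith
    then have r: "r \<ge> 1" "r\<^sup>2 = 2 * ln (real n)" by (simp_all add: r_def)
    have K: "K \<ge> 0" using r by (simp add: K_def)
    interpret prob_space M using sm by (simp add: sequence_model_def)
    have ind: "indep_vars (\<lambda>_. borel) e {1..n}"
      and e: "\<And>i. i \<in> {1..n} \<Longrightarrow> distributed M lborel (e i) std_normal_density"
      using sequence_model_std_normal[OF sm] \<open>\<sigma> > 0\<close> n1 unfolding e_def[abs_def] v_def by auto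
    \<comment> \<open>The exceptional coordinates: low resolution, or mean above the fraction
      \<open>\<delta>\<close> of the universal threshold \<open>r * v\<close>.\<close>
    define G where "G = {i \<in> {1..n}. i \<le> 2 ^ j J1 \<or> \<bar>\<mu> i\<bar> > \<delta> * (r * v)}"
    have G: "G \<subseteq> {1..n}" by (auto simp: G_def)
    define Q where "Q = (\<Sum>i\<in>{2 ^ j J1 + 1..n}. (\<mu> i)\<^sup>2)"
    have powr_n: "real n powr x = 2 powr (x * real (J1 + 1))" for x
      by (simp add: n powr_realpow[symmetric] powr_powr mult.commute flip: power_Suc of_nat_Suc)
    have "real (j J1) \<le> a * real (J1 + 1)" "real (j J1) \<ge> a * real (J1 + 1) - 1"
      using a(2) unfolding j_def by auto
    then have jj: "2 ^ j J1 \<le> real n powr a" "2 powr (- (2 * g * real (j J1))) \<le> 2 powr (2 * g) * real n powr (- (2 * g * a))"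
    proof -
      assume le: "real (j J1) \<le> a * real (J1 + 1)" and ge: "real (j J1) \<ge> a * real (J1 + 1) - 1"
      show "2 ^ j J1 \<le> real n powr a"
        unfolding powr_n using le by (simp add: powr_realpow[symmetric])
      have "2 * g * (a * real (J1 + 1) - 1) \<le> 2 * g * real (j J1)"
        using ge g by (intro mult_left_mono) auto
      then have "2 powr (- (2 * g * real (j J1))) \<le> 2 powr (2 * g + - (2 * g * a) * real (J1 + 1))"
        by (intro powr_mono) (auto simp: algebra_simps)
      then show "2 powr (- (2 * g * real (j J1))) \<le> 2 powr (2 * g) * real n powr (- (2 * g * a))"
        unfolding powr_n powr_add .
    qed
    have Q: "Q \<le> A * real n powr (- (2 * g * a))"
    proof -
      have "Q \<le> 2 * c\<^sup>2 * 2 powr (- (2 * g * real (j J1)))"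
        unfolding Q_def n g_def using assms J by (intro besov_body_tail_square_sum_le[OF \<mu>]) auto
      also have "\<dots> \<le> 2 * c\<^sup>2 * (2 powr (2 * g) * real n powr (- (2 * g * a)))"
        using jj(2) by (intro mult_left_mono) auto
      finally show ?thesis by (simp add: A_def)
    qed
    have small: "\<bar>\<mu> i\<bar> \<le> \<delta> * (r * v)" if "i \<in> {1..n} - G" for i
      using that by (auto simp: G_def)
    have cardG: "real (card G) \<le> real n powr a + A * C * real n powr (1 - 2 * g * a)"
    proof -
      define \<eta> where "\<eta> = \<delta> * (r * v)"
      have \<eta>: "\<eta> > 0" using \<delta> r v by (simp add: \<eta>_def)
      define L where "L = {i \<in> {2 ^ j J1 + 1..n}. \<bar>\<mu> i\<bar> > \<eta>}"
      have "card G \<le> card ({1..2 ^ j J1} \<union> L)"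
        by (intro card_mono) (auto simp: G_def L_def \<eta>_def)
      also have "\<dots> \<le> 2 ^ j J1 + card L"
        using card_Un_le[of "{1..2 ^ j J1}" L] by simp
      finally have "real (card G) \<le> 2 ^ j J1 + real (card L)"
        by (metis of_nat_add of_nat_le_iff of_nat_numeral of_nat_power)
      also have "\<dots> \<le> real n powr a + Q / \<eta>\<^sup>2"
        using jj(1) card_large_le[of "{2 ^ j J1 + 1..n}" \<eta> \<mu>] \<eta> unfolding L_def Q_def
        by (intro add_mono) auto
      \<comment> \<open>Because \<open>r \<ge> 1\<close>, the squared cutoff is at least \<delta>^2
        \<sigma>^2 / n; dropping the logarithm only weakens the bound.\<close>
      also have "Q / \<eta>\<^sup>2 \<le> (A * real n powr (- (2 * g * a))) / (\<delta>\<^sup>2 * \<sigma>\<^sup>2 / real n)"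
      proof (intro frac_le Q)
        have "1 * (\<delta>\<^sup>2 * \<sigma>\<^sup>2 / real n) \<le> r\<^sup>2 * (\<delta>\<^sup>2 * \<sigma>\<^sup>2 / real n)"
          using r(1) by (intro mult_right_mono one_le_power) auto
        then show "\<delta>\<^sup>2 * \<sigma>\<^sup>2 / real n \<le> \<eta>\<^sup>2"
          by (simp add: \<eta>_def v_def power_mult_distrib power_divide mult_ac)
      qed (use A0 \<delta> n1 \<open>\<sigma> > 0\<close> in auto)
      also have "\<dots> = A * (1 / (\<delta>\<^sup>2 * \<sigma>\<^sup>2)) * real n powr (1 - 2 * g * a)"
        using n1 by (simp add: powr_diff powr_minus field_simps)
      also have "\<dots> \<le> A * C * real n powr (1 - 2 * g * a)"
        using A0 by (intro mult_right_mono mult_left_mono) (auto simp: C_def)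
      finally show ?thesis by simp
    qed
    define R where "R \<omega> = 2 * \<sigma> * \<bar>\<Sum>i\<in>{1..n} - G. \<mu> i * e i \<omega>\<bar> + K * (\<Sum>i\<in>G. 1 + (e i \<omega>)\<^sup>2)
           + 2 * K * (\<Sum>i\<in>{1..n} - G. (1 + (e i \<omega>)\<^sup>2) * of_bool (\<bar>e i \<omega>\<bar> > (\<rho> - \<delta>) * r))" for \<omega>
    have "integrable M R"
      unfolding R_def[abs_def] using r \<kappa>0 assms \<theta> K
      by (intro remainder_expectation_le(1)[OF ind e G, where \<theta> = \<theta>]) (auto simp: \<kappa>_def)
    moreover have "expectation R \<le> B J1"
    proof -
      have "expectation R \<le> 2 * \<sigma> * sqrt (\<Sum>i\<in>{1..n} - G. (\<mu> i)\<^sup>2) + 2 * K * card G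
           + 2 * K * (n * (std_normal_exp_square \<theta> * exp (- \<theta> * (\<kappa> * r)\<^sup>2 / 2)))"
        unfolding R_def[abs_def] \<kappa>_def using r \<kappa>0 assms \<theta> K
        by (intro remainder_expectation_le(2)[OF ind e G, where \<theta> = \<theta>]) (auto simp: \<kappa>_def)
      \<comment> \<open>Since r^2 = 2 ln n, the Gaussian tail factor is a pure power of
        \<open>n\<close>.\<close>
      also have "- \<theta> * (\<kappa> * r)\<^sup>2 / 2 = - (\<theta> * \<kappa>\<^sup>2) * ln (real n)"
        by (simp add: power_mult_distrib r)
      also have "exp \<dots> = real n powr (- (\<theta> * \<kappa>\<^sup>2))"
        using n1 by (simp add: powr_def)
      also have "2 * \<sigma> * sqrt (\<Sum>i\<in>{1..n} - G. (\<mu> i)\<^sup>2) + 2 * K * card G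
           + 2 * K * (n * (std_normal_exp_square \<theta> * real n powr (- (\<theta> * \<kappa>\<^sup>2)))) \<le>
         2 * \<sigma> * sqrt (A * real n powr (- (2 * g * a))) +
         2 * K * (real n powr a + A * C * real n powr (1 - 2 * g * a)) +
         2 * K * (C * real n powr (1 - \<theta> * \<kappa>\<^sup>2))"
      proof (intro add_mono mult_left_mono cardG)
        have "(\<Sum>i\<in>{1..n} - G. (\<mu> i)\<^sup>2) \<le> Q"
          unfolding Q_def by (intro sum_mono2) (auto simp: G_def)
        then show "sqrt (\<Sum>i\<in>{1..n} - G. (\<mu> i)\<^sup>2) \<le> sqrt (A * real n powr (- (2 * g * a)))"
          using Q by simp
        have "real n * (std_normal_exp_square \<theta> * real n powr (- (\<theta> * \<kappa>\<^sup>2))) =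
            std_normal_exp_square \<theta> * real n powr (1 - \<theta> * \<kappa>\<^sup>2)"
          using n1 by (simp add: powr_diff powr_minus field_simps)
        also have "\<dots> \<le> C * real n powr (1 - \<theta> * \<kappa>\<^sup>2)"
          by (intro mult_right_mono) (auto simp: C_def)
        finally show "real n * (std_normal_exp_square \<theta> * real n powr (- (\<theta> * \<kappa>\<^sup>2))) \<le>
            C * real n powr (1 - \<theta> * \<kappa>\<^sup>2)" .
      qed (use \<open>\<sigma> > 0\<close> K in auto)
      also have "\<dots> = B J1"
        unfolding B_def approximation_rate_def K_def r_def n[symmetric]
        by (simp add: algebra_simps add_divide_distrib)
      finally show ?thesis .
    qed
    moreover have "\<bar>pivot_process {\<rho>..1} \<sigma> n \<mu> (\<lambda>i. X i \<omega>) u -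
                 \<sigma>\<^sup>2 / sqrt (real n) * (\<Sum>i=1..n. 1 - (e i \<omega>)\<^sup>2)\<bar> \<le> R \<omega>" if "u \<in> {\<rho>..1}" for \<omega> u
      unfolding R_def using n1 \<open>\<sigma> > 0\<close> \<rho>0 that \<delta> G small v
      by (intro pivot_process_approximation[OF _ _ _ _ _ _ v_def r_def _ _ K_def]) (auto simp: e_def)
    ultimately show "\<exists>R. integrable M R \<and> expectation R \<le> B J1 \<and>
              (\<forall>\<omega>. \<forall>u\<in>{\<rho>..1}. \<bar>pivot_process {\<rho>..1} \<sigma> n \<mu> (\<lambda>i. X i \<omega>) u -
                 \<sigma>\<^sup>2 / sqrt (real n) * (\<Sum>i=1..n. 1 - ((X i \<omega> - \<mu> i) / (\<sigma> / sqrt (real n)))\<^sup>2)\<bar> \<le> R \<omega>)"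
      unfolding e_def v_def by blast
  qed
  with B show thesis by (rule that)
qed

section \<open>Central limit theorem for sums of squares\<close>

text \<open>One infinite independent sequence on a fixed space: the classical central limit theorem
  concerns a single sequence, while the model may use a new space for every
  \<open>n\<close>.\<close>

lemma std_normal_coordinates:
  defines "P \<equiv> \<Pi>\<^sub>M i\<in>(UNIV :: nat set). std_normal_distribution"
  shows "prob_space P" "prob_space.indep_vars P (\<lambda>_. borel) (\<lambda>i \<omega>. \<omega> i) UNIV"
    and "\<And>i. distributed P lborel (\<lambda>\<omega>. \<omega> i) std_normal_density"
proof -
  interpret N: real_distribution std_normal_distribution by (rule real_dist_normal_dist)
  interpret pp: product_prob_space "\<lambda>_::nat. std_normal_distribution" UNIV
    by standard
  show "prob_space P" unfolding P_def by (rule pp.prob_space_axioms)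
  then interpret prob_space P .
  have sets: "sets P = sets (\<Pi>\<^sub>M i\<in>(UNIV :: nat set). borel)"
    unfolding P_def by (intro sets_PiM_cong) auto
  have [measurable]: "(\<lambda>\<omega>. \<omega> i) \<in> borel_measurable P" for i
    unfolding measurable_cong_sets[OF sets refl] by measurable
  have comp: "distr P borel (\<lambda>\<omega>. \<omega> i) = std_normal_distribution" for i
  proof -
    have "distr P borel (\<lambda>\<omega>. \<omega> i) = distr P std_normal_distribution (\<lambda>\<omega>. \<omega> i)"
      by (intro distr_cong) auto
    then show ?thesis using pp.PiM_component[of i] by (simp add: P_def)
  qed
  \<comment> \<open>The coordinate map is the identity, so the joint law is \<open>P\<close>, which
    is also the product of the marginals; this is independence.\<close>
  have "distr P (\<Pi>\<^sub>M i\<in>UNIV. borel) (\<lambda>x. \<lambda>i\<in>UNIV. x i) = P"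
    using distr_id2[OF sets[symmetric]] by (simp add: restrict_UNIV)
  moreover have "(\<Pi>\<^sub>M i\<in>UNIV. distr P borel (\<lambda>\<omega>. \<omega> i)) = P"
    unfolding comp by (simp add: P_def)
  ultimately show "indep_vars (\<lambda>_. borel) (\<lambda>i \<omega>. \<omega> i) UNIV"
    by (subst indep_vars_iff_distr_eq_PiM) simp_all
  have "distr P lborel (\<lambda>\<omega>. \<omega> i) = distr P borel (\<lambda>\<omega>. \<omega> i)" for i
    by (intro distr_cong) auto
  then show "distributed P lborel (\<lambda>\<omega>. \<omega> i) std_normal_density" for i
    using comp[of i] unfolding distributed_def by simp
qed

context prob_space
begin

lemma distr_std_normal_square:
  assumes "distributed M lborel e std_normal_density"
  shows "distr M borel (\<lambda>\<omega>. 1 - (e \<omega>)\<^sup>2) = distr std_normal_distribution borel (\<lambda>x. 1 - x\<^sup>2)"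
proof -
  have [measurable]: "e \<in> borel_measurable M"
    by (rule std_normal_distributed_measurable[OF assms])
  have "std_normal_distribution = distr M lborel e"
    using assms by (simp add: distributed_def)
  then have "distr std_normal_distribution borel (\<lambda>x. 1 - x\<^sup>2) = distr (distr M lborel e) borel (\<lambda>x. 1 - x\<^sup>2)"
    by simp
  also have "\<dots> = distr M borel (\<lambda>\<omega>. 1 - (e \<omega>)\<^sup>2)"
    by (subst distr_distr) (auto simp: comp_def)
  finally show ?thesis ..
qed

text \<open>Characteristic functions multiply over independent summands, so the index set enters
  only through its size.\<close>

lemma char_sum_std_normal_squares:
  assumes "finite I" and ind: "indep_vars (\<lambda>_. borel) e I"
    and e: "\<And>i. i \<in> I \<Longrightarrow> distributed M lborel (e i) std_normal_density"
  shows "char (distr M borel (\<lambda>\<omega>. \<Sum>i\<in>I. 1 - (e i \<omega>)\<^sup>2)) t =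
           char (distr std_normal_distribution borel (\<lambda>x. 1 - x\<^sup>2)) t ^ card I"
proof -
  have "indep_vars (\<lambda>_. borel) (\<lambda>i \<omega>. 1 - (e i \<omega>)\<^sup>2) I"
    by (rule indep_vars_compose2[OF ind]) auto
  then have "char (distr M borel (\<lambda>\<omega>. \<Sum>i\<in>I. 1 - (e i \<omega>)\<^sup>2)) t =
      (\<Prod>i\<in>I. char (distr M borel (\<lambda>\<omega>. 1 - (e i \<omega>)\<^sup>2)) t)"
    by (rule char_distr_sum)
  also have "\<dots> = (\<Prod>i\<in>I. char (distr std_normal_distribution borel (\<lambda>x. 1 - x\<^sup>2)) t)"
    by (intro prod.cong refl) (simp add: distr_std_normal_square[OF e])
  finally show ?thesis by simp
qed

end

text \<open>Levy uniqueness transfers the law of the sum from one probability space to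
  another.\<close>

lemma distr_sum_std_normal_squares_eq:
  fixes e :: "nat \<Rightarrow> 'a \<Rightarrow> real" and e' :: "nat \<Rightarrow> 'b \<Rightarrow> real"
  assumes "prob_space M" "prob_space M'" "finite I" "finite I'" "card I = card I'"
    and "prob_space.indep_vars M (\<lambda>_. borel) e I" "prob_space.indep_vars M' (\<lambda>_. borel) e' I'"
    and "\<And>i. i \<in> I \<Longrightarrow> distributed M lborel (e i) std_normal_density"
    and "\<And>i. i \<in> I' \<Longrightarrow> distributed M' lborel (e' i) std_normal_density"
  shows "distr M borel (\<lambda>\<omega>. \<Sum>i\<in>I. 1 - (e i \<omega>)\<^sup>2) = distr M' borel (\<lambda>\<omega>. \<Sum>i\<in>I'. 1 - (e' i \<omega>)\<^sup>2)"
proof -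
  interpret M: prob_space M by fact
  interpret M': prob_space M' by fact
  have [measurable]: "i \<in> I \<Longrightarrow> e i \<in> borel_measurable M" "j \<in> I' \<Longrightarrow> e' j \<in> borel_measurable M'" for i j
    using assms(8,9) M.std_normal_distributed_measurable M'.std_normal_distributed_measurable by auto
  show ?thesis
  proof (rule Levy_uniqueness)
    show "char (distr M borel (\<lambda>\<omega>. \<Sum>i\<in>I. 1 - (e i \<omega>)\<^sup>2)) =
        char (distr M' borel (\<lambda>\<omega>. \<Sum>i\<in>I'. 1 - (e' i \<omega>)\<^sup>2))" (is "?c = ?c'")
    proof
      fix t
      have "?c t = char (distr std_normal_distribution borel (\<lambda>x. 1 - x\<^sup>2)) t ^ card I"
        using assms by (intro M.char_sum_std_normal_squares)
      also have "\<dots> = ?c' t"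
        unfolding assms(5) using assms by (intro M'.char_sum_std_normal_squares[symmetric])
      finally show "?c t = ?c' t" .
    qed
  qed (intro M.real_distribution_distr M'.real_distribution_distr; measurable)+
qed

text \<open>A triangular array over varying spaces: the law of each row sum depends only on
  \<open>k J\<close>, so it may be realized on the fixed product space, where the central limit
  theorem holds along all \<open>n\<close> and hence along \<open>k\<close>.\<close>

lemma std_normal_squares_clt:
  fixes e :: "nat \<Rightarrow> nat \<Rightarrow> 'a \<Rightarrow> real" and g :: "real \<Rightarrow> real" and k :: "nat \<Rightarrow> nat"
  assumes k: "filterlim k at_top sequentially"
    and M: "\<And>J. prob_space (M J)"
    and ind: "\<And>J. prob_space.indep_vars (M J) (\<lambda>_. borel) (e J) {1..k J}"
    and e: "\<And>J i. i \<in> {1..k J} \<Longrightarrow> distributed (M J) lborel (e J i) std_normal_density"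
    and g: "\<And>x. isCont g x" "\<And>x. \<bar>g x\<bar> \<le> b"
  shows "(\<lambda>J. \<integral>\<omega>. g (c / sqrt (real (k J)) * (\<Sum>i=1..k J. 1 - (e J i \<omega>)\<^sup>2)) \<partial>M J)
           \<longlonglongrightarrow> (\<integral>x. g (c * sqrt 2 * x) \<partial>std_normal_distribution)"
proof -
  define P where "P = (\<Pi>\<^sub>M i\<in>(UNIV :: nat set). std_normal_distribution)"
  note P = std_normal_coordinates[folded P_def]
  interpret P: prob_space P by (rule P)
  have Pm [measurable]: "(\<lambda>\<omega>. \<omega> i) \<in> borel_measurable P" for i
    by (rule P.std_normal_distributed_measurable[OF P(3)])
  define \<Lambda> where "\<Lambda> n = distr P borel (\<lambda>\<omega>. (\<Sum>i<n. 1 - (\<omega> i)\<^sup>2) / sqrt (real n * (sqrt 2)\<^sup>2))" for n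
  have sq: "integrable P (\<lambda>\<omega>. (\<omega> i)\<^sup>2)" "P.expectation (\<lambda>\<omega>. (\<omega> i)\<^sup>2) = 1"
    and quart: "integrable P (\<lambda>\<omega>. (\<omega> i) ^ 4)" "P.expectation (\<lambda>\<omega>. (\<omega> i) ^ 4) = 3" for i
  proof -
    show "integrable P (\<lambda>\<omega>. (\<omega> i)\<^sup>2)" "P.expectation (\<lambda>\<omega>. (\<omega> i)\<^sup>2) = 1"
      by (intro P.std_normal_integrable_square P.std_normal_expectation_square P(3))+
    show "integrable P (\<lambda>\<omega>. (\<omega> i) ^ 4)"
      using distributed_integrable[OF P(3), of "\<lambda>x. x ^ 4" i] integrable_std_normal_moment[of 4] by simp
    show "P.expectation (\<lambda>\<omega>. (\<omega> i) ^ 4) = 3"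
      using distributed_integral[OF P(3), of "\<lambda>x. x ^ 4" i] integral_std_normal_moment_even[of 2]
      by (simp add: fact_numeral)
  qed
  \<comment> \<open>With fourth moment 3, the variance of 1 - e^2 is 1 - 2 + 3 = 2, the source of
    \<open>sqrt 2\<close> in the limit.\<close>
  have sq_eq: "(1 - x\<^sup>2)\<^sup>2 = 1 - 2 * x\<^sup>2 + x ^ 4" for x :: real
    by (simp add: power2_eq_square power4_eq_xxxx algebra_simps)
  have clt: "weak_conv_m \<Lambda> std_normal_distribution"
    unfolding \<Lambda>_def[abs_def]
  proof (rule P.central_limit_theorem_zero_mean)
    show "P.indep_vars (\<lambda>_. borel) (\<lambda>i \<omega>. 1 - (\<omega> i)\<^sup>2) UNIV"
      by (rule P.indep_vars_compose2[OF P(2)]) auto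
    show mean: "P.expectation (\<lambda>\<omega>. 1 - (\<omega> i)\<^sup>2) = 0" for i
      using sq P.prob_space by simp
    show "integrable P (\<lambda>\<omega>. (1 - (\<omega> i)\<^sup>2)\<^sup>2)" for i
      unfolding sq_eq using sq quart by simp
    show "P.variance (\<lambda>\<omega>. 1 - (\<omega> i)\<^sup>2) = (sqrt 2)\<^sup>2" for i
      unfolding mean using sq quart P.prob_space by (simp add: sq_eq)
    show "distr P borel (\<lambda>\<omega>. 1 - (\<omega> i)\<^sup>2) = distr std_normal_distribution borel (\<lambda>x. 1 - x\<^sup>2)" for i
      by (rule P.distr_std_normal_square[OF P(3)])
  qed simp
  have "(\<lambda>n. \<integral>x. g (c * sqrt 2 * x) \<partial>\<Lambda> n) \<longlonglongrightarrow> (\<integral>x. g (c * sqrt 2 * x) \<partial>std_normal_distribution)"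
  proof (rule weak_conv_imp_integral_bdd_continuous_conv[OF _ real_dist_normal_dist clt])
    show "real_distribution (\<Lambda> n)" for n
      unfolding \<Lambda>_def by (intro P.real_distribution_distr) simp
    show "isCont (\<lambda>x. g (c * sqrt 2 * x)) x" for x
      by (rule isCont_o2[OF _ g(1)]) (intro continuous_intros)
    show "norm (g (c * sqrt 2 * x)) \<le> b" for x using g(2) by simp
  qed
  from filterlim_compose[OF this k]
  have "(\<lambda>J. \<integral>x. g (c * sqrt 2 * x) \<partial>\<Lambda> (k J)) \<longlonglongrightarrow> (\<integral>x. g (c * sqrt 2 * x) \<partial>std_normal_distribution)" .
  moreover have "(\<integral>x. g (c * sqrt 2 * x) \<partial>\<Lambda> (k J)) =
      (\<integral>\<omega>. g (c / sqrt (real (k J)) * (\<Sum>i=1..k J. 1 - (e J i \<omega>)\<^sup>2)) \<partial>M J)" for J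
  proof -
    interpret MJ: prob_space "M J" by (rule M)
    have [measurable]: "i \<in> {1..k J} \<Longrightarrow> e J i \<in> borel_measurable (M J)" for i
      using e MJ.std_normal_distributed_measurable by auto
    have [measurable]: "g \<in> borel_measurable borel"
      using g(1) by (intro borel_measurable_continuous_onI continuous_at_imp_continuous_on) auto
    \<comment> \<open>The shift between zero-based and one-based indices is harmless, as only the
      number of summands matters.\<close>
    have "distr P borel (\<lambda>\<omega>. \<Sum>i<k J. 1 - (\<omega> i)\<^sup>2) = distr (M J) borel (\<lambda>\<omega>. \<Sum>i=1..k J. 1 - (e J i \<omega>)\<^sup>2)"
      by (rule distr_sum_std_normal_squares_eq[OF P(1) M _ _ _ P.indep_vars_subset[OF P(2)] ind P(3) e]) simp_all
    then have "(\<integral>y. g (c / sqrt (real (k J)) * y) \<partial>distr P borel (\<lambda>\<omega>. \<Sum>i<k J. 1 - (\<omega> i)\<^sup>2)) =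
       (\<integral>y. g (c / sqrt (real (k J)) * y) \<partial>distr (M J) borel (\<lambda>\<omega>. \<Sum>i=1..k J. 1 - (e J i \<omega>)\<^sup>2))"
      by simp
    then show ?thesis
      unfolding \<Lambda>_def by (simp add: integral_distr real_sqrt_mult)
  qed
  ultimately show ?thesis by simp
qed

section \<open>Weak convergence to a constant process\<close>

lemma mspace_linf: "mspace (linf T) = {f \<in> extensional T. bounded (f ` T)}"
  by (auto simp: linf_def Met_TC.fspace_def)

lemma mspace_linf_iff_bound:
  "f \<in> mspace (linf T) \<longleftrightarrow> f \<in> extensional T \<and> (\<exists>B. \<forall>u\<in>T. \<bar>f u\<bar> \<le> B)"
  by (auto simp: mspace_linf bounded_iff)

lemma mdist_linf_le:
  assumes "f \<in> mspace (linf T)" "g \<in> mspace (linf T)" "T \<noteq> {}"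
  shows "mdist (linf T) f g \<le> a \<longleftrightarrow> (\<forall>u\<in>T. \<bar>f u - g u\<bar> \<le> a)"
  using assms funspace_mdist_le[of f T euclidean_metric g a] by (simp add: linf_def dist_real_def)

lemma constant_in_linf: "(\<lambda>u\<in>T. z) \<in> mspace (linf T)"
  by (auto simp: mspace_linf_iff_bound)

lemma bounded_continuous_functional_epsilon_delta:
  assumes f: "f \<in> bounded_continuous_functionals T" and y: "y \<in> mspace (linf T)"
    and T: "T \<noteq> {}" and "\<epsilon> > 0"
  obtains d where "d > 0"
    and "\<And>x. x \<in> mspace (linf T) \<Longrightarrow> (\<And>u. u \<in> T \<Longrightarrow> \<bar>x u - y u\<bar> \<le> d) \<Longrightarrow> \<bar>f x - f y\<bar> < \<epsilon>"
proof -
  interpret Metric_space "mspace (linf T)" "mdist (linf T)" by simp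
  have cont: "continuous_map mtopology euclideanreal f"
    using f by (simp add: bounded_continuous_functionals_def mtopology_of_def)
  have "openin mtopology {x \<in> topspace mtopology. f x \<in> ball (f y) \<epsilon>}"
    by (rule openin_continuous_map_preimage[OF cont]) simp
  then obtain r where r: "r > 0" "mball y r \<subseteq> {x \<in> mspace (linf T). f x \<in> ball (f y) \<epsilon>}"
    using y \<open>\<epsilon> > 0\<close> unfolding openin_mtopology by auto
  \<comment> \<open>Pointwise bounds give only a non-strict bound on the distance; halving the
    radius lands in the open ball.\<close>
  show thesis
  proof (rule that[of "r / 2"])
    fix x assume x: "x \<in> mspace (linf T)" and "\<And>u. u \<in> T \<Longrightarrow> \<bar>x u - y u\<bar> \<le> r / 2"
    then have "mdist (linf T) x y \<le> r / 2"
      using mdist_linf_le[OF x y T] by blast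
    then have "x \<in> mball y r" using x y r(1) by (simp add: in_mball commute)
    then show "\<bar>f x - f y\<bar> < \<epsilon>" using r(2) by (auto simp: dist_real_def)
  qed (use r in simp)
qed

text \<open>Makes \<open>f\<close> on constants an admissible test function for weak convergence on
  the real line.\<close>

lemma isCont_functional_on_constants:
  assumes f: "f \<in> bounded_continuous_functionals T" and T: "T \<noteq> {}"
  shows "isCont (\<lambda>z. f (\<lambda>u\<in>T. z)) z"
proof (rule continuous_at_eps_delta[THEN iffD2], intro allI impI)
  fix \<epsilon> :: real assume "\<epsilon> > 0"
  from bounded_continuous_functional_epsilon_delta[OF f constant_in_linf T this, of z]
  obtain d where "d > 0"
    and "\<And>x. x \<in> mspace (linf T) \<Longrightarrow> (\<And>u. u \<in> T \<Longrightarrow> \<bar>x u - (\<lambda>u\<in>T. z) u\<bar> \<le> d) \<Longrightarrow> \<bar>f x - f (\<lambda>u\<in>T. z)\<bar> < \<epsilon>"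
    by blast
  then show "\<exists>d>0. \<forall>x'. dist x' z < d \<longrightarrow> dist (f (\<lambda>u\<in>T. x')) (f (\<lambda>u\<in>T. z)) < \<epsilon>"
    by (intro exI[of _ d]) (auto simp: dist_real_def constant_in_linf)
qed

text \<open>
  A continuous functional need not be uniformly continuous, but it is so near the constant
  functions with values in a bounded interval, since these form a compact set.
\<close>

lemma uniform_continuity_near_constants:
  assumes f: "f \<in> bounded_continuous_functionals T" and T: "T \<noteq> {}" and "\<epsilon> > 0"
  obtains d where "d > 0"
    and "\<And>x z. x \<in> mspace (linf T) \<Longrightarrow> \<bar>z\<bar> \<le> A \<Longrightarrow> (\<And>u. u \<in> T \<Longrightarrow> \<bar>x u - z\<bar> \<le> d) \<Longrightarrow>
           \<bar>f x - f (\<lambda>u\<in>T. z)\<bar> < \<epsilon>"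
proof (rule ccontr)
  assume contra: "\<not> thesis"
  have "\<exists>x z. x \<in> mspace (linf T) \<and> \<bar>z\<bar> \<le> A \<and> (\<forall>u\<in>T. \<bar>x u - z\<bar> \<le> inverse (real (Suc n))) \<and>
      \<not> \<bar>f x - f (\<lambda>u\<in>T. z)\<bar> < \<epsilon>" for n
    using contra that[of "inverse (real (Suc n))"] by fastforce
  then obtain x z where xz: "\<And>n. x n \<in> mspace (linf T)" "\<And>n. \<bar>z n\<bar> \<le> A"
      "\<And>n u. u \<in> T \<Longrightarrow> \<bar>x n u - z n\<bar> \<le> inverse (real (Suc n))"
      "\<And>n. \<not> \<bar>f (x n) - f (\<lambda>u\<in>T. z n)\<bar> < \<epsilon>"
    by metis
  have "\<forall>n. z n \<in> {-A..A}" using xz(2) by (auto simp: abs_le_iff minus_le_iff)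
  then obtain l r where lr: "strict_mono r" "(z \<circ> r) \<longlonglongrightarrow> l"
    using compact_Icc[of "-A" A] unfolding compact_def by blast
  \<comment> \<open>Continuity at the constant \<open>l\<close>, a cluster point of the
    counterexamples, puts both values of \<open>f\<close> within \<open>\<epsilon> / 2\<close> of
    the same number, which contradicts their separation.\<close>
  from bounded_continuous_functional_epsilon_delta[OF f constant_in_linf T, of "\<epsilon> / 2" l] \<open>\<epsilon> > 0\<close>
  obtain d where d: "d > 0"
    and close: "\<And>x. x \<in> mspace (linf T) \<Longrightarrow> (\<And>u. u \<in> T \<Longrightarrow> \<bar>x u - (\<lambda>u\<in>T. l) u\<bar> \<le> d) \<Longrightarrow>
      \<bar>f x - f (\<lambda>u\<in>T. l)\<bar> < \<epsilon> / 2"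
    by (metis half_gt_zero)
  have "\<forall>\<^sub>F n in sequentially. dist ((z \<circ> r) n) l < d / 2"
    using d by (intro tendstoD[OF lr(2)]) auto
  moreover have "\<forall>\<^sub>F n in sequentially. inverse (real (Suc n)) < d / 2"
    using d by (intro order_tendstoD(2)[OF LIMSEQ_inverse_real_of_nat]) auto
  ultimately have "\<forall>\<^sub>F n in sequentially. False"
  proof eventually_elim
    case (elim n)
    have "n \<le> r n" by (rule seq_suble[OF lr(1)])
    then have inv: "inverse (real (Suc (r n))) < d / 2"
      using elim(2) by (smt (verit) inverse_eq_divide frac_le of_nat_0_less_iff of_nat_le_iff Suc_le_mono zero_less_Suc)
    have zl: "\<bar>z (r n) - l\<bar> < d / 2" using elim(1) by (simp add: dist_real_def)
    have "\<bar>f (x (r n)) - f (\<lambda>u\<in>T. l)\<bar> < \<epsilon> / 2"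
    proof (rule close[OF xz(1)])
      fix u assume "u \<in> T"
      then have "\<bar>x (r n) u - l\<bar> \<le> d"
        using xz(3)[of u "r n"] inv zl by linarith
      then show "\<bar>x (r n) u - (\<lambda>u\<in>T. l) u\<bar> \<le> d"
        using \<open>u \<in> T\<close> by simp
    qed
    moreover have "\<bar>f (\<lambda>u\<in>T. z (r n)) - f (\<lambda>u\<in>T. l)\<bar> < \<epsilon> / 2"
      using zl d by (intro close constant_in_linf) auto
    ultimately show False using xz(4)[of "r n"] by linarith
  qed
  then show False by simp
qed

text \<open>\<open>h + D\<close> is an admissible majorant of \<open>g\<close>, and every admissible
  majorant dominates \<open>h - D\<close>; \<open>g\<close> itself may be nonmeasurable. These two
  facts also give the nonemptiness and lower bound that make the real infimum meaningful.\<close>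

lemma outer_expectation_approx:
  assumes h: "integrable M h" and D: "integrable M D"
    and le: "\<And>\<omega>. \<omega> \<in> space M \<Longrightarrow> \<bar>g \<omega> - h \<omega>\<bar> \<le> D \<omega>"
  shows "\<bar>outer_expectation M g - (\<integral>\<omega>. h \<omega> \<partial>M)\<bar> \<le> (\<integral>\<omega>. D \<omega> \<partial>M)"
proof -
  define S where "S = {(\<integral>\<omega>. U \<omega> \<partial>M) | U. integrable M U \<and> (\<forall>\<omega>\<in>space M. g \<omega> \<le> U \<omega>)}"
  have "g \<omega> \<le> h \<omega> + D \<omega>" if "\<omega> \<in> space M" for \<omega> using le[OF that] by linarith
  then have "(\<integral>\<omega>. h \<omega> + D \<omega> \<partial>M) \<in> S" unfolding S_def using h D by fastforce
  then have mem: "(\<integral>\<omega>. h \<omega> \<partial>M) + (\<integral>\<omega>. D \<omega> \<partial>M) \<in> S" using h D by simp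
  have lower: "(\<integral>\<omega>. h \<omega> \<partial>M) - (\<integral>\<omega>. D \<omega> \<partial>M) \<le> y" if "y \<in> S" for y
  proof -
    from that obtain U where U: "integrable M U" "\<And>\<omega>. \<omega> \<in> space M \<Longrightarrow> g \<omega> \<le> U \<omega>"
      and y: "y = (\<integral>\<omega>. U \<omega> \<partial>M)" by (auto simp: S_def)
    have "(\<integral>\<omega>. h \<omega> - D \<omega> \<partial>M) \<le> y"
      unfolding y
    proof (intro integral_mono Bochner_Integration.integrable_diff h D U)
      fix \<omega> assume "\<omega> \<in> space M"
      then show "h \<omega> - D \<omega> \<le> U \<omega>" using le[of \<omega>] U(2)[of \<omega>] by linarith
    qed
    then show ?thesis using h D by simp
  qed
  have "Inf S \<le> (\<integral>\<omega>. h \<omega> \<partial>M) + (\<integral>\<omega>. D \<omega> \<partial>M)"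
    using lower by (intro cInf_lower[OF mem] bdd_belowI)
  moreover have "(\<integral>\<omega>. h \<omega> \<partial>M) - (\<integral>\<omega>. D \<omega> \<partial>M) \<le> Inf S"
    using mem lower by (intro cInf_greatest) auto
  ultimately show ?thesis by (simp add: outer_expectation_def S_def)
qed

lemma outer_expectation_eq_integral:
  "integrable M g \<Longrightarrow> outer_expectation M g = (\<integral>\<omega>. g \<omega> \<partial>M)"
  using outer_expectation_approx[of M g "\<lambda>_. 0" g] by simp

text \<open>A Slutsky argument under outer expectation. \<open>f (Y J)\<close> is close to
  \<open>f\<close> at the constant \<open>Z J\<close> unless \<open>Z J\<close> is large or the
  error exceeds \<open>d\<close>; the former is rare by tightness, the latter by Markov's
  inequality.\<close>

lemma law_tendsto_constant_process:
  fixes M :: "nat \<Rightarrow> 'w measure" and Z :: "nat \<Rightarrow> 'w \<Rightarrow> real"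
  assumes f: "f \<in> bounded_continuous_functionals T" and T: "T \<noteq> {}"
    and Y: "\<And>J. random_map T (M J) (Y J)" and Z: "\<And>J. Z J \<in> borel_measurable (M J)"
    and approx: "\<forall>\<^sub>F J in sequentially. \<exists>R. integrable (M J) R \<and> (\<integral>\<omega>. R \<omega> \<partial>M J) \<le> B J \<and>
                   (\<forall>\<omega>. \<forall>u\<in>T. \<bar>Y J \<omega> u - Z J \<omega>\<bar> \<le> R \<omega>)"
    and B: "B \<longlonglongrightarrow> 0" and \<nu>: "real_distribution \<nu>"
    and weak: "\<And>(g :: real \<Rightarrow> real) b. (\<And>x. isCont g x) \<Longrightarrow> (\<And>x. \<bar>g x\<bar> \<le> b) \<Longrightarrow>
                 (\<lambda>J. \<integral>\<omega>. g (Z J \<omega>) \<partial>M J) \<longlonglongrightarrow> (\<integral>x. g x \<partial>\<nu>)"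
  shows "(\<lambda>J. law T (M J) (Y J) f) \<longlonglongrightarrow> (\<integral>z. f (\<lambda>u\<in>T. z) \<partial>\<nu>)"
proof -
  interpret \<nu>: real_distribution \<nu> by (rule \<nu>)
  define g where "g z = f (\<lambda>u\<in>T. z)" for z
  have "bounded (f ` mspace (linf T))"
    using f by (simp add: bounded_continuous_functionals_def)
  then obtain b where b: "b > 0" "\<And>x. x \<in> mspace (linf T) \<Longrightarrow> \<bar>f x\<bar> \<le> b"
    unfolding bounded_pos by (auto)
  have gc: "isCont g z" for z
    unfolding g_def[abs_def] by (rule isCont_functional_on_constants[OF f T])
  then have [measurable]: "g \<in> borel_measurable borel"
    by (intro borel_measurable_continuous_onI continuous_at_imp_continuous_on) auto
  have gb: "\<bar>g z\<bar> \<le> b" for z unfolding g_def by (intro b constant_in_linf)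
  have lim_g: "(\<lambda>J. \<integral>\<omega>. g (Z J \<omega>) \<partial>M J) \<longlonglongrightarrow> (\<integral>x. g x \<partial>\<nu>)"
    by (rule weak[OF gc gb])
  have "(\<lambda>J. law T (M J) (Y J) f - (\<integral>\<omega>. g (Z J \<omega>) \<partial>M J)) \<longlonglongrightarrow> 0"
  proof (rule tendstoI)
    fix \<epsilon> :: real assume \<epsilon>: "\<epsilon> > 0"
    \<comment> \<open>A continuous ramp rising from 0 to 1 as |x| goes from \<open>A\<close> to
      \<open>A + 1\<close>. It replaces the indicator of large values, so that weak convergence can
      be applied to it.\<close>
    define \<phi> where "\<phi> A x = min 1 (max 0 (\<bar>x\<bar> - real A))" for A x
    have \<phi>c: "isCont (\<phi> A) x" for A x
      unfolding \<phi>_def[abs_def] by (intro continuous_intros)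
    then have [measurable]: "\<phi> A \<in> borel_measurable borel" for A
      by (intro borel_measurable_continuous_onI continuous_at_imp_continuous_on) auto
    have \<phi>b: "0 \<le> \<phi> A x" "\<phi> A x \<le> 1" for A x by (auto simp: \<phi>_def)
    have "(\<lambda>A. \<integral>x. \<phi> A x \<partial>\<nu>) \<longlonglongrightarrow> (\<integral>x. 0 \<partial>\<nu>)"
    proof (rule integral_dominated_convergence[where w = "\<lambda>_. 1"])
      show "AE x in \<nu>. (\<lambda>A. \<phi> A x) \<longlonglongrightarrow> 0"
      proof (rule AE_I2)
        fix x
        obtain N :: nat where N: "\<bar>x\<bar> \<le> real N" using real_arch_simple by blast
        have "\<forall>\<^sub>F A in sequentially. \<phi> A x = 0"
          using eventually_ge_at_top[of N] by eventually_elim (use N in \<open>auto simp: \<phi>_def\<close>)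
        then show "(\<lambda>A. \<phi> A x) \<longlonglongrightarrow> 0" by (rule tendsto_eventually)
      qed
    qed (auto simp: \<phi>b)
    then have "\<forall>\<^sub>F A in sequentially. (\<integral>x. \<phi> A x \<partial>\<nu>) < \<epsilon> / (8 * b)"
      using \<epsilon> b by (intro order_tendstoD(2)) auto
    then obtain A where A: "(\<integral>x. \<phi> A x \<partial>\<nu>) < \<epsilon> / (8 * b)"
      using eventually_happens' by force
    have "(\<lambda>J. \<integral>\<omega>. \<phi> A (Z J \<omega>) \<partial>M J) \<longlonglongrightarrow> (\<integral>x. \<phi> A x \<partial>\<nu>)"
      using \<phi>b by (intro weak[OF \<phi>c, where b = 1]) (auto simp: abs_le_iff intro: order_trans[of _ 0])
    then have ev1: "\<forall>\<^sub>F J in sequentially. (\<integral>\<omega>. \<phi> A (Z J \<omega>) \<partial>M J) < \<epsilon> / (8 * b)"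
      using A by (rule order_tendstoD(2))
    obtain d where d: "d > 0"
      and close: "\<And>x z. x \<in> mspace (linf T) \<Longrightarrow> \<bar>z\<bar> \<le> real A + 1 \<Longrightarrow>
        (\<And>u. u \<in> T \<Longrightarrow> \<bar>x u - z\<bar> \<le> d) \<Longrightarrow> \<bar>f x - f (\<lambda>u\<in>T. z)\<bar> < \<epsilon> / 4"
      using uniform_continuity_near_constants[OF f T, of "\<epsilon> / 4" "real A + 1"] \<epsilon> by auto
    have ev2: "\<forall>\<^sub>F J in sequentially. B J < d * \<epsilon> / (8 * b)"
      using B \<epsilon> b d by (intro order_tendstoD(2)) auto
    show "\<forall>\<^sub>F J in sequentially. dist (law T (M J) (Y J) f - (\<integral>\<omega>. g (Z J \<omega>) \<partial>M J)) 0 < \<epsilon>"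
      using ev1 ev2 approx
    proof eventually_elim
      case (elim J)
      interpret prob_space "M J" using Y[of J] by (simp add: random_map_def)
      note [measurable] = Z[of J]
      obtain R where R: "integrable (M J) R" "expectation R \<le> B J"
        "\<And>\<omega> u. u \<in> T \<Longrightarrow> \<bar>Y J \<omega> u - Z J \<omega>\<bar> \<le> R \<omega>"
        using elim(3) by blast
      \<comment> \<open>The part \<open>\<epsilon> / 4\<close> covers the good event. Off it the
        difference is at most \<open>2 * b\<close>, and the bracket is at least 1.\<close>
      define D where "D \<omega> = \<epsilon> / 4 + 2 * b * (\<phi> A (Z J \<omega>) + R \<omega> / d)" for \<omega>
      have int: "integrable (M J) (\<lambda>\<omega>. \<phi> A (Z J \<omega>))"
        by (rule integrable_const_bound[where B = 1]) (auto simp: \<phi>b)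
      have R0: "R \<omega> \<ge> 0" for \<omega>
        using T R(3)[of _ \<omega>] by (meson abs_ge_zero all_not_in_conv order_trans)
      have "\<bar>law T (M J) (Y J) f - expectation (\<lambda>\<omega>. g (Z J \<omega>))\<bar> \<le> expectation D"
      proof -
        have "\<bar>outer_expectation (M J) (\<lambda>\<omega>. f (Y J \<omega>)) - expectation (\<lambda>\<omega>. g (Z J \<omega>))\<bar> \<le> expectation D"
        proof (rule outer_expectation_approx)
          show "integrable (M J) (\<lambda>\<omega>. g (Z J \<omega>))"
            by (rule integrable_const_bound[where B = b]) (auto simp: gb)
          show "integrable (M J) D"
            unfolding D_def[abs_def] using int R(1) by auto
          fix \<omega> assume "\<omega> \<in> space (M J)"
          then have YJ: "Y J \<omega> \<in> mspace (linf T)" using Y[of J] by (auto simp: random_map_def)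
          show "\<bar>f (Y J \<omega>) - g (Z J \<omega>)\<bar> \<le> D \<omega>"
          proof (cases "\<bar>Z J \<omega>\<bar> \<le> real A + 1 \<and> R \<omega> \<le> d")
            case True
            then have "\<bar>f (Y J \<omega>) - g (Z J \<omega>)\<bar> < \<epsilon> / 4"
              unfolding g_def by (intro close YJ) (auto intro: order_trans[OF R(3)])
            also have "\<dots> \<le> D \<omega>" unfolding D_def using b d R0 \<phi>b by simp
            finally show ?thesis by simp
          next
            case False
            have "1 \<le> \<phi> A (Z J \<omega>) + R \<omega> / d"
            proof (cases "\<bar>Z J \<omega>\<bar> \<le> real A + 1")
              case True
              then have "1 \<le> R \<omega> / d" using False d by simp
              then show ?thesis using \<phi>b(1)[of A "Z J \<omega>"] by linarith
            next
              case False
              then have "\<phi> A (Z J \<omega>) = 1" by (simp add: \<phi>_def)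
              then show ?thesis using R0 d by simp
            qed
            then have "2 * b * 1 \<le> 2 * b * (\<phi> A (Z J \<omega>) + R \<omega> / d)"
              using b by (intro mult_left_mono) auto
            moreover have "\<bar>f (Y J \<omega>) - g (Z J \<omega>)\<bar> \<le> 2 * b"
              using b(2)[OF YJ] gb[of "Z J \<omega>"] by linarith
            ultimately show ?thesis using \<epsilon> by (simp add: D_def)
          qed
        qed
        then show ?thesis using f by (simp add: law_def)
      qed
      also have "expectation D = \<epsilon> / 4 + 2 * b * (expectation (\<lambda>\<omega>. \<phi> A (Z J \<omega>)) + expectation R / d)"
        unfolding D_def[abs_def] using int R(1) prob_space by simp
      also have "\<dots> \<le> \<epsilon> / 4 + 2 * b * (\<epsilon> / (8 * b) + (d * \<epsilon> / (8 * b)) / d)"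
        using elim R(2) b d by (intro add_left_mono mult_left_mono add_mono divide_right_mono) auto
      also have "\<dots> = \<epsilon> * 3 / 4" using b d by (simp add: field_simps)
      also have "\<dots> < \<epsilon>" using \<epsilon> by simp
      finally show ?case by (simp add: dist_real_def)
    qed
  qed
  from tendsto_add[OF this lim_g] show ?thesis by (simp add: g_def)
qed

section \<open>The limit process and the paths of the pivot process\<close>

lemma open_constants_vimage:
  assumes G: "openin (mtopology_of (linf T)) G" and T: "T \<noteq> {}"
  shows "open {z. (\<lambda>u\<in>T. z) \<in> G}"
proof -
  interpret Metric_space "mspace (linf T)" "mdist (linf T)" by simp
  show ?thesis
    unfolding open_dist
  proof
    fix z assume "z \<in> {z. (\<lambda>u\<in>T. z) \<in> G}"
    then have "(\<lambda>u\<in>T. z) \<in> G" by simp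
    then obtain r where r: "r > 0" "mball (\<lambda>u\<in>T. z) r \<subseteq> G"
      using G unfolding mtopology_of_def openin_mtopology by blast
    have "(\<lambda>u\<in>T. y) \<in> G" if "dist y z < r / 2" for y
    proof -
      have "mdist (linf T) (\<lambda>u\<in>T. z) (\<lambda>u\<in>T. y) \<le> r / 2"
        unfolding mdist_linf_le[OF constant_in_linf constant_in_linf T]
        using that by (auto simp: dist_real_def abs_minus_commute)
      then have "(\<lambda>u\<in>T. y) \<in> mball (\<lambda>u\<in>T. z) r"
        using r(1) by (simp add: in_mball constant_in_linf)
      then show ?thesis using r(2) by blast
    qed
    then show "\<exists>e>0. \<forall>y. dist y z < e \<longrightarrow> y \<in> {z. (\<lambda>u\<in>T. z) \<in> G}"
      using r(1) by (intro exI[of _ "r / 2"]) auto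
  qed
qed

text \<open>Sending \<open>z\<close> to the constant function preserves distances, so preimages of
  open sets are open and the rational constants are dense in the range.\<close>

lemma separable_borel_map_constant:
  assumes "prob_space M" and Z: "Z \<in> borel_measurable M" and T: "T \<noteq> {}"
  shows "separable_borel_map T M (\<lambda>\<omega>. \<lambda>u\<in>T. Z \<omega>)"
  unfolding separable_borel_map_def
proof (intro conjI allI impI)
  show "random_map T M (\<lambda>\<omega>. \<lambda>u\<in>T. Z \<omega>)"
    using assms by (simp add: random_map_def constant_in_linf)
  fix G assume "openin (mtopology_of (linf T)) G"
  then have "Z -` {z. (\<lambda>u\<in>T. z) \<in> G} \<inter> space M \<in> sets M"
    by (intro measurable_sets[OF Z] borel_open open_constants_vimage T)
  then show "(\<lambda>\<omega>. \<lambda>u\<in>T. Z \<omega>) -` G \<inter> space M \<in> sets M"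
    by (simp add: vimage_def)
next
  interpret Metric_space "mspace (linf T)" "mdist (linf T)" by simp
  define D where "D = (\<lambda>z. \<lambda>u\<in>T. z) ` (\<rat> :: real set)"
  have "(\<lambda>u\<in>T. z) \<in> mtopology_of (linf T) closure_of D" for z
    unfolding mtopology_of_def metric_closure_of
  proof (safe intro!: constant_in_linf)
    fix r :: real assume "r > 0"
    then obtain y where y: "y \<in> \<rat>" "z < y" "y < z + r / 2"
      using Rats_dense_in_real[of z "z + r / 2"] by auto
    then have "mdist (linf T) (\<lambda>u\<in>T. z) (\<lambda>u\<in>T. y) \<le> r / 2"
      unfolding mdist_linf_le[OF constant_in_linf constant_in_linf T] by auto
    then have "(\<lambda>u\<in>T. y) \<in> mball (\<lambda>u\<in>T. z) r"
      using \<open>r > 0\<close> by (simp add: in_mball constant_in_linf)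
    then show "\<exists>y\<in>D. y \<in> mball (\<lambda>u\<in>T. z) r"
      using y(1) by (auto simp: D_def)
  qed
  then show "\<exists>D. countable D \<and> D \<subseteq> mspace (linf T) \<and>
      (AE \<omega> in M. (\<lambda>u\<in>T. Z \<omega>) \<in> mtopology_of (linf T) closure_of D)"
    by (intro exI[of _ D]) (auto simp: D_def constant_in_linf countable_rat)
qed

text \<open>Constancy in \<open>u\<close> turns every linear combination into a multiple of
  \<open>e\<close>; a vanishing multiple is the degenerate normal of variance 0.\<close>

lemma mean_zero_gaussian_process_constant:
  assumes "prob_space M" and e: "distributed M lborel e std_normal_density"
  shows "mean_zero_gaussian_process T M (\<lambda>\<omega>. \<lambda>u\<in>T. \<tau> * e \<omega>)"
  unfolding mean_zero_gaussian_process_def gaussian_process_def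
proof (intro conjI allI impI ballI)
  interpret prob_space M by fact
  have [measurable]: "e \<in> borel_measurable M" by (rule std_normal_distributed_measurable[OF e])
  show "(\<integral>\<omega>. (\<lambda>u\<in>T. \<tau> * e \<omega>) u \<partial>M) = 0" if "u \<in> T" for u
    using that standard_normal_distributed_expectation[OF e] by simp
  fix F :: "real set" and b assume "finite F \<and> F \<subseteq> T"
  then have eq: "(\<Sum>u\<in>F. b u * (\<lambda>u\<in>T. \<tau> * e \<omega>) u) = (sum b F * \<tau>) * e \<omega>" for \<omega>
    by (auto simp: sum_distrib_right intro!: sum.cong)
  show "\<exists>a s. normal_rv M (\<lambda>\<omega>. \<Sum>u\<in>F. b u * (\<lambda>u\<in>T. \<tau> * e \<omega>) u) a s"
    unfolding eq
  proof (intro exI)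
    show "normal_rv M (\<lambda>\<omega>. (sum b F * \<tau>) * e \<omega>) 0 \<bar>sum b F * \<tau>\<bar>"
    proof (cases "sum b F * \<tau> = 0")
      case False
      then show ?thesis
        using normal_density_affine[OF e, of "sum b F * \<tau>" 0] by (simp add: normal_rv_def)
    qed (auto simp: normal_rv_def)
  qed
qed fact

text \<open>Boundedness of the paths follows from the approximation with \<open>G = {1..n}\<close>:
  no small coordinates remain, and the bound is free of \<open>u\<close>.\<close>

lemma random_map_pivot_process:
  assumes "prob_space M" "n \<ge> 1" "\<sigma> > 0" "\<rho> \<ge> 0"
  shows "random_map {\<rho>..1} M (\<lambda>\<omega>. pivot_process {\<rho>..1} \<sigma> n \<mu> (\<lambda>i. X i \<omega>))"
proof -
  have "pivot_process {\<rho>..1} \<sigma> n \<mu> x \<in> mspace (linf {\<rho>..1})" for x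
  proof -
    define e where "e i = (x i - \<mu> i) / (\<sigma> / sqrt (real n))" for i
    have e: "x i = \<mu> i + \<sigma> / sqrt (real n) * e i" for i
      using assms by (simp add: e_def)
    define C where "C = \<sigma>\<^sup>2 / sqrt (real n) * (\<Sum>i=1..n. 1 - (e i)\<^sup>2)"
    define D where "D = 2 * \<sigma>\<^sup>2 * (1 + sqrt (2 * ln (real n))) / sqrt (real n) * (\<Sum>i=1..n. 1 + (e i)\<^sup>2)"
    have *: "\<bar>pivot_process {\<rho>..1} \<sigma> n \<mu> x u - C\<bar> \<le> D" if "u \<in> {\<rho>..1}" for u
      using pivot_process_approximation[where e = e and \<mu> = \<mu> and x = x,
          OF assms(2,3,4) that zero_le_one subset_refl refl refl e _ refl]
      by (simp add: C_def D_def)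
    have "\<bar>pivot_process {\<rho>..1} \<sigma> n \<mu> x u\<bar> \<le> D + \<bar>C\<bar>" if "u \<in> {\<rho>..1}" for u
      using *[OF that] by linarith
    moreover have "pivot_process {\<rho>..1} \<sigma> n \<mu> x \<in> extensional {\<rho>..1}"
      by (simp add: pivot_process_def)
    ultimately show ?thesis
      unfolding mspace_linf_iff_bound by blast
  qed
  then show ?thesis using assms by (simp add: random_map_def)
qed

text \<open>Supplies nonemptiness: an empty supremum in \<open>ereal\<close> is minus infinity,
  which would spoil the limit 0.\<close>

lemma zero_in_besov_body:
  assumes "c > 0"
  shows "(\<lambda>_. 0) \<in> besov_body J0 p q s c"
proof -
  have "besov_level p q s (\<lambda>_. 0) = (\<lambda>_. 0)"
    by (simp add: besov_level_def beta_coeff_def fun_eq_iff)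
  then show ?thesis
    using assms by (simp add: besov_body_def besov_norm_def)
qed

section \<open>Convergence of the pivot process\<close>

theorem theorem7p2:
  fixes J0 :: nat and p q s c \<sigma> \<rho> :: real
    and M :: "nat \<Rightarrow> (nat \<Rightarrow> real) \<Rightarrow> 'w measure"
    and X :: "nat \<Rightarrow> (nat \<Rightarrow> real) \<Rightarrow> nat \<Rightarrow> 'w \<Rightarrow> real"
  assumes "p \<ge> 1" and "q \<ge> 1" and "besov_gamma p s > 1/2" and "c > 0"
    and "1 / sqrt 2 < \<rho>" and "\<rho> < 1"
    and "\<sigma> > 0"
    and "\<And>J1 n \<mu>. n = 2 ^ (J1 + 1) \<Longrightarrow> sequence_model \<sigma> n \<mu> (M n \<mu>) (X n \<mu>)"
  shows "\<exists>(N :: 'w measure) W.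
           mean_zero_gaussian_process {\<rho>..1} N W \<and>
           separable_borel_map {\<rho>..1} N W \<and>
           (\<forall>m. metrizes_weak_convergence TYPE('w) {\<rho>..1} m \<longrightarrow>
              (\<lambda>J1. let n = 2 ^ (J1 + 1) in
                 SUP \<mu>\<in>besov_body J0 p q s c.
                   ereal (m (law {\<rho>..1} (M n \<mu>)
                              (\<lambda>\<omega>. pivot_process {\<rho>..1} \<sigma> n \<mu> (\<lambda>i. X n \<mu> i \<omega>)))
                            (law {\<rho>..1} N W)))
              \<longlonglongrightarrow> 0)"
proof -

  \<comment> \<open>Standardized noise and the random constant\<close>
  define T where "T = {\<rho>..1}"
  have T: "T \<noteq> {}" using \<open>\<rho> < 1\<close> by (simp add: T_def)
  have "1 / sqrt 2 > (0 :: real)" by simp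
  then have \<rho>0: "\<rho> \<ge> 0" using assms(5) by linarith
  define k where "k J = (2 :: nat) ^ (J + 1)" for J :: nat
  have k1: "k J \<ge> 1" for J by (simp add: k_def)
  have model: "sequence_model \<sigma> (k J) \<mu> (M (k J) \<mu>) (X (k J) \<mu>)" for J \<mu>
    using assms(8) by (simp add: k_def)
  define e where "e J \<mu> i \<omega> = (X (k J) \<mu> i \<omega> - \<mu> i) / (\<sigma> / sqrt (real (k J)))" for J \<mu> i \<omega>
  have prob: "prob_space (M (k J) \<mu>)"
    and ind: "prob_space.indep_vars (M (k J) \<mu>) (\<lambda>_. borel) (e J \<mu>) {1..k J}"
    and normal: "i \<in> {1..k J} \<Longrightarrow> distributed (M (k J) \<mu>) lborel (e J \<mu> i) std_normal_density"
    for J \<mu> i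
    using sequence_model_std_normal[OF model \<open>\<sigma> > 0\<close> k1] by (simp_all add: e_def[abs_def])
  have filt_k: "filterlim k at_top sequentially"
    unfolding k_def[abs_def]
    by (intro filterlim_compose[OF _ filterlim_add_const_nat_at_top])
       (simp add: filterlim_subseq strict_mono_def)
  define Y where "Y J \<mu> \<omega> = pivot_process T \<sigma> (k J) \<mu> (\<lambda>i. X (k J) \<mu> i \<omega>)" for J \<mu> \<omega>
  define Z where "Z J \<mu> \<omega> = \<sigma>\<^sup>2 / sqrt (real (k J)) * (\<Sum>i=1..k J. 1 - (e J \<mu> i \<omega>)\<^sup>2)" for J \<mu> \<omega>
  have Y: "random_map T (M (k J) \<mu>) (Y J \<mu>)" for J \<mu>
    unfolding Y_def[abs_def] T_def by (rule random_map_pivot_process[OF prob k1 \<open>\<sigma> > 0\<close> \<rho>0])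
  have em: "e J \<mu> i \<in> borel_measurable (M (k J) \<mu>)" if "i \<in> {1..k J}" for J \<mu> i
    by (rule prob_space.std_normal_distributed_measurable[OF prob normal[OF that]])
  have Z: "Z J \<mu> \<in> borel_measurable (M (k J) \<mu>)" for J \<mu>
    unfolding Z_def[abs_def]
    by (intro borel_measurable_times borel_measurable_sum borel_measurable_diff borel_measurable_power em) auto

  \<comment> \<open>The limit process\<close>
  define \<tau> where "\<tau> = \<sigma>\<^sup>2 * sqrt 2"
  \<comment> \<open>The limit has to live on a measure over \<open>'w\<close>, so a space of the
    given model is reused. Its first standardized noise is standard normal, and \<tau>^2 = 2
    \<sigma>^4 is the limiting variance.\<close>
  define N where "N = M (k 0) (\<lambda>_. 0)"
  define e0 where "e0 = e 0 (\<lambda>_. 0) 1"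
  define W where "W \<omega> = (\<lambda>u\<in>T. \<tau> * e0 \<omega>)" for \<omega>
  have N: "prob_space N" unfolding N_def by (rule prob)
  have e0: "distributed N lborel e0 std_normal_density"
    unfolding N_def e0_def using k1[of 0] by (intro normal) simp
  have [measurable]: "e0 \<in> borel_measurable N"
    by (rule prob_space.std_normal_distributed_measurable[OF N e0])
  have gauss: "mean_zero_gaussian_process T N W"
    unfolding W_def[abs_def] by (rule mean_zero_gaussian_process_constant[OF N e0])
  have sep: "separable_borel_map T N W"
    unfolding W_def[abs_def] by (rule separable_borel_map_constant[OF N _ T]) simp
  define \<nu> where "\<nu> = distr std_normal_distribution borel (\<lambda>x. \<tau> * x)"
  interpret std: real_distribution std_normal_distribution by (rule real_dist_normal_dist)
  have \<nu>: "real_distribution \<nu>" unfolding \<nu>_def by (intro std.real_distribution_distr) simp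
  have law_W: "law T N W f = (\<integral>z. f (\<lambda>u\<in>T. z) \<partial>\<nu>)" if f: "f \<in> bounded_continuous_functionals T" for f
  proof -
    have cont: "continuous_on UNIV (\<lambda>z. f (\<lambda>u\<in>T. z))"
      using isCont_functional_on_constants[OF f T] by (simp add: continuous_at_imp_continuous_on)
    then have [measurable]: "(\<lambda>z. f (\<lambda>u\<in>T. z)) \<in> borel_measurable borel"
      by (rule borel_measurable_continuous_onI)
    obtain b where b: "\<And>x. x \<in> mspace (linf T) \<Longrightarrow> \<bar>f x\<bar> \<le> b"
      using f by (auto simp: bounded_continuous_functionals_def bounded_iff)
    interpret N: prob_space N by (rule N)
    have "integrable N (\<lambda>\<omega>. f (W \<omega>))"
      unfolding W_def
      by (rule N.integrable_const_bound[where B = b]) (auto intro!: b constant_in_linf)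
    then have "law T N W f = (\<integral>\<omega>. f (\<lambda>u\<in>T. \<tau> * e0 \<omega>) \<partial>N)"
      using f by (simp add: law_def outer_expectation_eq_integral W_def)
    also have "\<dots> = (\<integral>x. std_normal_density x * f (\<lambda>u\<in>T. \<tau> * x) \<partial>lborel)"
      using distributed_integral[OF e0, of "\<lambda>x. f (\<lambda>u\<in>T. \<tau> * x)"] by simp
    also have "\<dots> = (\<integral>z. f (\<lambda>u\<in>T. z) \<partial>\<nu>)"
      unfolding \<nu>_def by (simp add: integral_distr integral_density)
    finally show ?thesis .
  qed

  \<comment> \<open>Weak convergence along sequences in the Besov body\<close>
  obtain B where B: "B \<longlonglongrightarrow> 0"
    and approx: "\<forall>\<^sub>F J in sequentially. \<forall>n \<mu> (M :: 'w measure) X.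
           n = 2 ^ (J + 1) \<longrightarrow> \<mu> \<in> besov_body J0 p q s c \<longrightarrow> sequence_model \<sigma> n \<mu> M X \<longrightarrow>
           (\<exists>R. integrable M R \<and> integral\<^sup>L M R \<le> B J \<and>
              (\<forall>\<omega>. \<forall>u\<in>{\<rho>..1}. \<bar>pivot_process {\<rho>..1} \<sigma> n \<mu> (\<lambda>i. X i \<omega>) u -
                 \<sigma>\<^sup>2 / sqrt (real n) * (\<Sum>i=1..n. 1 - ((X i \<omega> - \<mu> i) / (\<sigma> / sqrt (real n)))\<^sup>2)\<bar> \<le> R \<omega>))"
    by (rule pivot_process_uniform_approximation[OF assms(1-7)])
  \<comment> \<open>The parameter may vary with \<open>J\<close> arbitrarily within the body; this
    yields uniformity, since a failure would occur along some such sequence.\<close>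
  have weak: "weakly_converges T (\<lambda>J. law T (M (k J) (\<mu> J)) (Y J (\<mu> J))) (law T N W)"
    if \<mu>: "\<And>J. \<mu> J \<in> besov_body J0 p q s c" for \<mu>
    unfolding weakly_converges_def
  proof
    fix f assume f: "f \<in> bounded_continuous_functionals T"
    show "(\<lambda>J. law T (M (k J) (\<mu> J)) (Y J (\<mu> J)) f) \<longlonglongrightarrow> law T N W f"
      unfolding law_W[OF f]
    proof (rule law_tendsto_constant_process[OF f T Y Z _ B \<nu>])
      show "\<forall>\<^sub>F J in sequentially. \<exists>R. integrable (M (k J) (\<mu> J)) R \<and>
          (\<integral>\<omega>. R \<omega> \<partial>M (k J) (\<mu> J)) \<le> B J \<and>
          (\<forall>\<omega>. \<forall>u\<in>T. \<bar>Y J (\<mu> J) \<omega> u - Z J (\<mu> J) \<omega>\<bar> \<le> R \<omega>)"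
        using approx
      proof (rule eventually_mono)
        fix J assume *: "\<forall>n \<mu> (M :: 'w measure) X.
           n = 2 ^ (J + 1) \<longrightarrow> \<mu> \<in> besov_body J0 p q s c \<longrightarrow> sequence_model \<sigma> n \<mu> M X \<longrightarrow>
           (\<exists>R. integrable M R \<and> integral\<^sup>L M R \<le> B J \<and>
              (\<forall>\<omega>. \<forall>u\<in>{\<rho>..1}. \<bar>pivot_process {\<rho>..1} \<sigma> n \<mu> (\<lambda>i. X i \<omega>) u -
                 \<sigma>\<^sup>2 / sqrt (real n) * (\<Sum>i=1..n. 1 - ((X i \<omega> - \<mu> i) / (\<sigma> / sqrt (real n)))\<^sup>2)\<bar> \<le> R \<omega>))"
        show "\<exists>R. integrable (M (k J) (\<mu> J)) R \<and>
            (\<integral>\<omega>. R \<omega> \<partial>M (k J) (\<mu> J)) \<le> B J \<and>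
            (\<forall>\<omega>. \<forall>u\<in>T. \<bar>Y J (\<mu> J) \<omega> u - Z J (\<mu> J) \<omega>\<bar> \<le> R \<omega>)"
          unfolding Y_def Z_def e_def T_def
          by (rule *[rule_format, OF k_def \<mu> model])
      qed
      fix g :: "real \<Rightarrow> real" and b
      assume g: "\<And>x. isCont g x" "\<And>x. \<bar>g x\<bar> \<le> b"
      then have [measurable]: "g \<in> borel_measurable borel"
        by (intro borel_measurable_continuous_onI continuous_at_imp_continuous_on) auto
      have "(\<integral>x. g (\<sigma>\<^sup>2 * sqrt 2 * x) \<partial>std_normal_distribution) = (\<integral>x. g x \<partial>\<nu>)"
        unfolding \<nu>_def \<tau>_def by (subst integral_distr) auto
      then show "(\<lambda>J. \<integral>\<omega>. g (Z J (\<mu> J) \<omega>) \<partial>M (k J) (\<mu> J)) \<longlonglongrightarrow> (\<integral>x. g x \<partial>\<nu>)"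
        using std_normal_squares_clt[where M = "\<lambda>J. M (k J) (\<mu> J)" and e = "\<lambda>J. e J (\<mu> J)" and k = k
            and g = g and b = b and c = "\<sigma>\<^sup>2", OF filt_k prob ind normal g]
        unfolding Z_def by simp
    qed
  qed

  \<comment> \<open>Uniformity over the Besov body\<close>
  have "(\<lambda>J. SUP \<mu>\<in>besov_body J0 p q s c. ereal (m (law T (M (k J) \<mu>) (Y J \<mu>)) (law T N W)))
      \<longlonglongrightarrow> 0" if m: "metrizes_weak_convergence TYPE('w) T m" for m
  proof -
    define d where "d J \<mu> = m (law T (M (k J) \<mu>) (Y J \<mu>)) (law T N W)" for J \<mu>
    interpret m: Metric_space "laws TYPE('w) T" m
      using m by (simp add: metrizes_weak_convergence_def)
    have d0: "d J \<mu> \<ge> 0" for J \<mu> by (simp add: d_def)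
    have d_lim: "(\<lambda>J. d J (\<mu> J)) \<longlonglongrightarrow> 0" if "\<And>J. \<mu> J \<in> besov_body J0 p q s c" for \<mu>
    proof -
      have "\<forall>J. law T (M (k J) (\<mu> J)) (Y J (\<mu> J)) \<in> laws TYPE('w) T"
        unfolding laws_def using Y by blast
      moreover have "weakly_converges T (\<lambda>J. law T (M (k J) (\<mu> J)) (Y J (\<mu> J))) (law T N W)"
        by (intro weak that)
      moreover have "law T N W \<in> separable_laws TYPE('w) T"
        unfolding separable_laws_def using sep by blast
      moreover have "(\<lambda>k. m (\<Lambda>s k) \<Lambda>) \<longlonglongrightarrow> 0"
        if "\<forall>k. \<Lambda>s k \<in> laws TYPE('w) T" "\<Lambda> \<in> separable_laws TYPE('w) T" "weakly_converges T \<Lambda>s \<Lambda>" for \<Lambda>s \<Lambda>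
        using m that unfolding metrizes_weak_convergence_def by blast
      ultimately show ?thesis unfolding d_def by simp
    qed
    show ?thesis
      unfolding d_def[symmetric]
    proof (rule order_tendstoI)
      fix a :: ereal assume "a < 0"
      have "0 \<le> (SUP \<mu>\<in>besov_body J0 p q s c. ereal (d J \<mu>))" for J
        using zero_in_besov_body[OF \<open>c > 0\<close>] d0 by (intro SUP_upper2) auto
      then show "\<forall>\<^sub>F J in sequentially. a < (SUP \<mu>\<in>besov_body J0 p q s c. ereal (d J \<mu>))"
        using \<open>a < 0\<close> by (intro always_eventually allI) (rule less_le_trans)
    next
      fix a :: ereal assume "0 < a"
      then obtain \<epsilon> where \<epsilon>: "0 < ereal \<epsilon>" "ereal \<epsilon> < a"
        using ereal_dense2 by blast
      \<comment> \<open>Picks a parameter violating \<open>\<epsilon>\<close> whenever one exists.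
        The default 0 keeps the sequence in the body, so its distances tend to 0 and violations
        eventually cease.\<close>
      define \<mu> where "\<mu> J = (if \<exists>\<mu>\<in>besov_body J0 p q s c. d J \<mu> > \<epsilon>
        then SOME \<mu>. \<mu> \<in> besov_body J0 p q s c \<and> d J \<mu> > \<epsilon> else (\<lambda>_. 0))" for J
      have bad: "\<mu> J \<in> besov_body J0 p q s c \<and> d J (\<mu> J) > \<epsilon>"
        if "\<exists>\<mu>\<in>besov_body J0 p q s c. d J \<mu> > \<epsilon>" for J
        unfolding \<mu>_def using that someI_ex[of "\<lambda>\<mu>. \<mu> \<in> besov_body J0 p q s c \<and> d J \<mu> > \<epsilon>"] by auto
      have "\<mu> J \<in> besov_body J0 p q s c" for J
        using bad[of J] zero_in_besov_body[OF \<open>c > 0\<close>] by (auto simp: \<mu>_def split: if_splits)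
      from order_tendstoD(2)[OF d_lim[OF this], of \<epsilon>]
      have "\<forall>\<^sub>F J in sequentially. d J (\<mu> J) < \<epsilon>" using \<epsilon> by simp
      then show "\<forall>\<^sub>F J in sequentially. (SUP \<mu>\<in>besov_body J0 p q s c. ereal (d J \<mu>)) < a"
      proof eventually_elim
        case (elim J)
        then have "\<not> (\<exists>\<mu>\<in>besov_body J0 p q s c. d J \<mu> > \<epsilon>)" using bad[of J] by auto
        then have "(SUP \<mu>\<in>besov_body J0 p q s c. ereal (d J \<mu>)) \<le> ereal \<epsilon>"
          by (intro SUP_least) (auto simp: not_less)
        then show ?case using \<epsilon>(2) by (rule le_less_trans)
      qed
    qed
  qed
  then show ?thesis
    using gauss sep unfolding Let_def Y_def[abs_def] k_def T_def by blast
qed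

end
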